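(* The species of hollow hypertrees with edges decorated by $\widehat{\operatorname{PreLie}}$ is isomorphic to the species of 2-coloured rooted trees.
   Context: A hypergraph on a finite set $V$ is a pair $(V,E)$ with $E$ a set of subsets of $V$ of cardinality at least two (the edges). A hypertree on $V$ is a hypergraph with $V\neq\emptyset$ whose bipartite incidence graph (on $V\sqcup E$) is a tree. A hollow hypertree on $I$ is a hypertree on $\{\#\}\sqcup I$ such that $\#$ (the gap) belongs to exactly one edge, called the hollow edge. In a hollow hypertree the petiole of an edge is its vertex nearest to the gap (for the hollow edge, the petiole is the gap). $\operatorname{PreLie}$ is the species assigning to a finite set $I$ the set of rooted trees with vertex set $I$, and $\widehat{\operatorname{PreLie}}$ is a linear species with differential $\operatorname{PreLie}$. A hollow hypertree decorated by $\widehat{\operatorname{PreLie}}$ is a hollow hypertree together with, for every edge $e$, a rooted tree whose vertex set is the set of vertices of $e$ different from the petiole of $e$. The corresponding species assigns to $I$ the set of such structures on $\{\#\}\sqcup I$. A 2-coloured rooted tree on $I$ is a rooted tree with vertex set $I$ together with a map from its set of edges to $\{0,1\}$. A species is a functor from finite sets and bijections to finite sets; an isomorphism of species is a natural family of bijections. *)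

theory Defs
  imports Main "HOL-Library.FuncSet"
begin

section \<open>Species\<close>

text \<open>
  A species is presented on the category of finite sets of elements of a type \<open>'a\<close> and
  bijections between them.  A bijection \<open>f : I \<rightarrow> J\<close> is given by \<open>I\<close> together with a function
  that matters only on \<open>I\<close>; \<open>transp F I f\<close> is the induced map from \<open>struct F I\<close> to
  \<open>struct F J\<close>, where \<open>J = f ` I\<close>.  All constants below are polymorphic in \<open>'a\<close>.
\<close>

record ('a, 's) species_data =
  struct :: "'a set \<Rightarrow> 's set"
  transp :: "'a set \<Rightarrow> ('a \<Rightarrow> 'a) \<Rightarrow> 's \<Rightarrow> 's"

locale species =
  fixes F :: "('a, 's) species_data"
  assumes finite_struct: "finite I \<Longrightarrow> finite (struct F I)"
    and transp_closed:
      "finite I \<Longrightarrow> bij_betw f I J \<Longrightarrow> s \<in> struct F I \<Longrightarrow> transp F I f s \<in> struct F J"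
    and transp_cong:
      "finite I \<Longrightarrow> bij_betw f I J \<Longrightarrow> (\<And>x. x \<in> I \<Longrightarrow> f x = g x) \<Longrightarrow> s \<in> struct F I
        \<Longrightarrow> transp F I f s = transp F I g s"
    and transp_id: "finite I \<Longrightarrow> s \<in> struct F I \<Longrightarrow> transp F I id s = s"
    and transp_comp:
      "finite I \<Longrightarrow> bij_betw f I J \<Longrightarrow> bij_betw g J K \<Longrightarrow> s \<in> struct F I
        \<Longrightarrow> transp F I (g \<circ> f) s = transp F J g (transp F I f s)"

definition species_isomorphic ::
  "('a, 's) species_data \<Rightarrow> ('a, 't) species_data \<Rightarrow> bool" where
  "species_isomorphic F G \<longleftrightarrow> species F \<and> species G \<and>
     (\<exists>\<phi>. (\<forall>I. finite I \<longrightarrow> bij_betw (\<phi> I) (struct F I) (struct G I)) \<and>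
          (\<forall>I J f. finite I \<longrightarrow> bij_betw f I J \<longrightarrow>
             (\<forall>s\<in>struct F I. \<phi> J (transp F I f s) = transp G I f (\<phi> I s))))"

text \<open>
  Maps \<open>c\<close> defined on a set \<open>A\<close> are made unique by being \<open>undefined\<close> outside \<open>A\<close>.  Such a map is
  pushed forward along \<open>g\<close>, injective on \<open>A\<close>, with \<open>h a\<close> acting on the value at \<open>a\<close>.
\<close>

definition push_map :: "('e \<Rightarrow> 'e) \<Rightarrow> ('e \<Rightarrow> 'x \<Rightarrow> 'x) \<Rightarrow> 'e set \<Rightarrow> ('e \<Rightarrow> 'x) \<Rightarrow> 'e \<Rightarrow> 'x" where
  "push_map g h A c = (\<lambda>b \<in> g ` A. h (inv_into A g b) (c (inv_into A g b)))"


section \<open>Finite simple graphs and trees\<close>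

text \<open>
  The predicate \<open>tree\<close> of the AFP entry \<open>Graph_Theory\<close> forbids only directed cycles, so it accepts
  digraphs whose underlying undirected graph is not a tree (and rejects symmetric digraphs with
  an arc).  Undirected graphs are therefore given here by a set of two-element edges.
\<close>

definition sgraph :: "'v set \<Rightarrow> 'v set set \<Rightarrow> bool" where
  "sgraph V E \<longleftrightarrow> finite V \<and> (\<forall>e\<in>E. e \<subseteq> V \<and> card e = 2)"

definition adj :: "'v set set \<Rightarrow> 'v rel" where
  "adj E = {(u, v). {u, v} \<in> E}"

definition connected_graph :: "'v set \<Rightarrow> 'v set set \<Rightarrow> bool" where
  "connected_graph V E \<longleftrightarrow> V \<noteq> {} \<and> (\<forall>u\<in>V. \<forall>v\<in>V. (u, v) \<in> (adj E)\<^sup>*)"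

definition graph_cycle :: "'v set set \<Rightarrow> 'v list \<Rightarrow> bool" where
  "graph_cycle E xs \<longleftrightarrow> 3 \<le> length xs \<and> distinct xs \<and>
     (\<forall>i<length xs. {xs ! i, xs ! (Suc i mod length xs)} \<in> E)"

definition tree_graph :: "'v set \<Rightarrow> 'v set set \<Rightarrow> bool" where
  "tree_graph V E \<longleftrightarrow> sgraph V E \<and> connected_graph V E \<and> (\<nexists>xs. graph_cycle E xs)"

definition graph_dist :: "'v set set \<Rightarrow> 'v \<Rightarrow> 'v \<Rightarrow> nat" where
  "graph_dist E u v = (LEAST n. (u, v) \<in> adj E ^^ n)"


section \<open>Rooted trees, with or without 2-coloured edges\<close>

text \<open>A rooted tree is a pair \<open>(r, E)\<close> of its root and its set of edges.\<close>

type_synonym 'a rtree = "'a \<times> 'a set set"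

definition rooted_trees :: "'a set \<Rightarrow> 'a rtree set" where
  "rooted_trees I = {(r, E). r \<in> I \<and> tree_graph I E}"

definition map_rtree :: "('a \<Rightarrow> 'a) \<Rightarrow> 'a rtree \<Rightarrow> 'a rtree" where
  "map_rtree f = (\<lambda>(r, E). (f r, (`) f ` E))"

definition PreLie :: "('a, 'a rtree) species_data" where
  "PreLie = \<lparr> struct = rooted_trees, transp = (\<lambda>I f. map_rtree f) \<rparr>"

type_synonym 'a coloured_rtree = "'a rtree \<times> ('a set \<Rightarrow> nat)"

definition two_coloured_rooted_trees :: "('a, 'a coloured_rtree) species_data" where
  "two_coloured_rooted_trees =
     \<lparr> struct = (\<lambda>I. {((r, E), c). (r, E) \<in> rooted_trees I \<and> c \<in> E \<rightarrow>\<^sub>E {0, 1}}),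
       transp = (\<lambda>I f ((r, E), c). (map_rtree f (r, E), push_map ((`) f) (\<lambda>_ x. x) E c)) \<rparr>"


section \<open>Hypertrees and hollow hypertrees\<close>

definition hypergraph :: "'v set \<Rightarrow> 'v set set \<Rightarrow> bool" where
  "hypergraph V E \<longleftrightarrow> finite V \<and> (\<forall>e\<in>E. e \<subseteq> V \<and> 2 \<le> card e)"

definition incidence_verts :: "'v set \<Rightarrow> 'v set set \<Rightarrow> ('v + 'v set) set" where
  "incidence_verts V E = V <+> E"

definition incidence_edges :: "'v set set \<Rightarrow> ('v + 'v set) set set" where
  "incidence_edges E = {{Inl v, Inr e} |v e. e \<in> E \<and> v \<in> e}"

definition hypertree :: "'v set \<Rightarrow> 'v set set \<Rightarrow> bool" where
  "hypertree V E \<longleftrightarrow> hypergraph V E \<and> V \<noteq> {} \<and>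
     tree_graph (incidence_verts V E) (incidence_edges E)"

text \<open>The set \<open>{#} \<squnion> I\<close> is rendered in \<open>'a option\<close>, with \<open>None\<close> as the gap.\<close>

definition with_gap :: "'a set \<Rightarrow> 'a option set" where
  "with_gap I = insert None (Some ` I)"

definition hollow_hypertree :: "'a set \<Rightarrow> 'a option set set \<Rightarrow> bool" where
  "hollow_hypertree I E \<longleftrightarrow> hypertree (with_gap I) E \<and> (\<exists>!e. e \<in> E \<and> None \<in> e)"

text \<open>
  The vertex of \<open>e\<close> nearest to the gap, for the distance in the incidence graph; for the hollow
  edge it is the gap, at distance 0.
\<close>

definition petiole :: "'a option set set \<Rightarrow> 'a option set \<Rightarrow> 'a option" where
  "petiole E e = arg_min_on (\<lambda>v. graph_dist (incidence_edges E) (Inl None) (Inl v)) e"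

text \<open>
  A hollow hypertree whose edges are decorated by a linear species with differential \<open>S\<close> is a pair
  \<open>(E, d)\<close> of a hollow hypertree and a map \<open>d\<close> giving for each edge an \<open>S\<close>-structure on its
  vertices other than the petiole.
\<close>

definition decorated_hollow_hypertrees ::
  "('a option, 's) species_data
    \<Rightarrow> ('a, 'a option set set \<times> ('a option set \<Rightarrow> 's)) species_data" where
  "decorated_hollow_hypertrees S =
     \<lparr> struct = (\<lambda>I. {(E, d). hollow_hypertree I E \<and>
                              d \<in> (\<Pi>\<^sub>E e\<in>E. struct S (e - {petiole E e}))}),
       transp = (\<lambda>I f (E, d).
         ((`) (map_option f) ` E,
          push_map ((`) (map_option f))
            (\<lambda>e. transp S (e - {petiole E e}) (map_option f)) E d)) \<rparr>"

definition hollow_hypertrees_PreLie ::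
  "('a, 'a option set set \<times> ('a option set \<Rightarrow> 'a option rtree)) species_data" where
  "hollow_hypertrees_PreLie = decorated_hollow_hypertrees PreLie"

end

theory Submission
  imports Defs
begin

text \<open>
  Both species are compared with pairs of a parent map and a set of marked vertices. In a
  2-coloured rooted tree, mark the root and every vertex joined to its parent by an edge of
  colour 1. In a decorated hollow hypertree, mark the root of the rooted tree decorating each
  edge; the parent of a marked vertex is the petiole of its edge, the parent of any other vertex
  is its parent in the decoration.
\<close>

section \<open>Rooted trees and parent maps\<close>

text \<open>The obstacle is that the two species speak of trees differently: absence of cycles in a
  set of two-element edges on one side, and on the other the incidence graph, with petioles selected
  by graph distance. Both are brought to one form: a function sending every vertex except the root
  to its parent, with a rank in \<open>nat\<close> that strictly drops along it. The rank stands for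
  acyclicity and drives the inductions, so each construction of a tree only has to supply one. In
  the common form the gap is the parent of the root, which is why the root counts as marked: it
  starts the hollow edge. A colour is then one bit at the child end of an edge, and choosing these
  bits freely means choosing where the tree is cut into hyperedges. The functor laws are verified
  directly only for the intermediate species; the two others inherit them along natural
  bijections.\<close>

definition parent_map :: "'v set \<Rightarrow> 'v \<Rightarrow> ('v \<Rightarrow> 'v) \<Rightarrow> bool" where
  "parent_map V r p \<longleftrightarrow> r \<in> V \<and> (\<forall>v\<in>V - {r}. p v \<in> V) \<and>
     (\<exists>h::'v \<Rightarrow> nat. \<forall>v\<in>V - {r}. h (p v) < h v)"

definition parent_edges :: "'v set \<Rightarrow> 'v \<Rightarrow> ('v \<Rightarrow> 'v) \<Rightarrow> 'v set set" where
  "parent_edges V r p = (\<lambda>v. {v, p v}) ` (V - {r})"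

lemma parent_edgesI: "v \<in> V \<Longrightarrow> v \<noteq> r \<Longrightarrow> {v, p v} \<in> parent_edges V r p"
  by (auto simp: parent_edges_def)

lemma parent_edges_doubleton:
  assumes "{u, v} \<in> parent_edges V r p"
  shows "u \<in> V - {r} \<and> p u = v \<or> v \<in> V - {r} \<and> p v = u"
  using assms by (auto simp: parent_edges_def doubleton_eq_iff)

lemma sym_adj: "sym (adj E)"
  by (auto simp: sym_def adj_def insert_commute)

lemma adj_rtrancl_sym: "(u, v) \<in> (adj E)\<^sup>* \<Longrightarrow> (v, u) \<in> (adj E)\<^sup>*"
  using sym_rtrancl[OF sym_adj] by (metis symD)

text \<open>Climbing along \<open>p\<close> stays in \<open>V\<close> and lowers the rank, so it can
  only stop at \<open>r\<close>.\<close>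

lemma parent_map_connected:
  assumes "parent_map V r p" "v \<in> V"
  shows "(v, r) \<in> (adj (parent_edges V r p))\<^sup>*"
proof -
  from assms(1) obtain h :: "'a \<Rightarrow> nat" where h: "\<forall>v\<in>V - {r}. h (p v) < h v"
    by (auto simp: parent_map_def)
  show ?thesis using assms(2)
  proof (induction "h v" arbitrary: v rule: less_induct)
    case less
    show ?case
    proof (cases "v = r")
      case False
      then have "p v \<in> V" "h (p v) < h v" using less.prems assms(1) h by (auto simp: parent_map_def)
      then have "(p v, r) \<in> (adj (parent_edges V r p))\<^sup>*" using less.hyps by blast
      moreover have "(v, p v) \<in> adj (parent_edges V r p)"
        using False less.prems by (auto simp: adj_def intro: parent_edgesI)
      ultimately show ?thesis by (meson converse_rtrancl_into_rtrancl)
    qed simp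
  qed
qed

text \<open>A cycle would have a vertex of maximal rank, and both of its neighbours would be its parent.\<close>

lemma parent_edges_no_cycle:
  assumes "parent_map V r p"
  shows "\<not> graph_cycle (parent_edges V r p) xs"
proof
  assume c: "graph_cycle (parent_edges V r p) xs"
  let ?n = "length xs"
  from assms obtain h :: "'a \<Rightarrow> nat" where h: "\<forall>v\<in>V - {r}. h (p v) < h v"
    by (auto simp: parent_map_def)
  have n: "3 \<le> ?n" and d: "distinct xs"
    and e: "\<And>i. i < ?n \<Longrightarrow> {xs ! i, xs ! (Suc i mod ?n)} \<in> parent_edges V r p"
    using c by (auto simp: graph_cycle_def)
  have "finite (h ` set xs)" "h ` set xs \<noteq> {}" using n by auto
  then obtain x where x: "x \<in> set xs" "h x = Max (h ` set xs)"
    using Max_in by (metis (no_types, lifting) imageE)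
  then obtain i where i: "i < ?n" "xs ! i = x" by (auto simp: in_set_conv_nth)
  have mx: "h y \<le> h x" if "y \<in> set xs" for y using x that by auto
  have par: "y = p x" if "{x, y} \<in> parent_edges V r p" "y \<in> set xs" for y
    using parent_edges_doubleton[OF that(1)] h mx[OF that(2)] by (metis not_less)
  \<comment> \<open>\<open>j\<close> and \<open>k\<close> are the cyclic successor and predecessor
    of \<open>i\<close>; they differ because a cycle has length at least 3.\<close>
  define j where "j = Suc i mod ?n"
  define k where "k = (if i = 0 then ?n - 1 else i - 1)"
  have "0 < ?n" using n by linarith
  then have jk: "j < ?n" "k < ?n" "Suc k mod ?n = i" using i
    by (auto simp: j_def k_def)
  have "j \<noteq> k" using i n
    by (cases "Suc i = ?n") (auto simp: j_def k_def)
  have "xs ! j = p x" using par e[OF i(1)] i jk by (simp add: j_def)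
  moreover have "xs ! k = p x" using par e[OF jk(2)] i jk by (simp add: insert_commute)
  ultimately show False using \<open>j \<noteq> k\<close> jk d nth_eq_iff_index_eq by metis
qed

lemma parent_edges_tree_graph:
  assumes "finite V" "parent_map V r p"
  shows "tree_graph V (parent_edges V r p)"
proof -
  have "sgraph V (parent_edges V r p)"
    unfolding sgraph_def
  proof (intro conjI ballI)
    fix e assume "e \<in> parent_edges V r p"
    then obtain v where v: "v \<in> V - {r}" "e = {v, p v}" by (auto simp: parent_edges_def)
    moreover have "p v \<in> V" "p v \<noteq> v"
      using v assms(2) unfolding parent_map_def by (blast, metis less_irrefl)
    ultimately show "e \<subseteq> V" "card e = 2" by auto
  qed (rule assms)
  moreover have "connected_graph V (parent_edges V r p)"
    unfolding connected_graph_def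
    using parent_map_connected[OF assms(2)] assms(2)
    by (metis adj_rtrancl_sym empty_iff parent_map_def rtrancl_trans)
  ultimately show ?thesis
    using parent_edges_no_cycle[OF assms(2)] by (auto simp: tree_graph_def)
qed

section \<open>Extracting a parent map from a tree, and its uniqueness\<close>

lemma rtrancl_distinct_path:
  assumes "(u, v) \<in> R\<^sup>*"
  obtains xs where "xs \<noteq> []" "hd xs = u" "last xs = v" "distinct xs"
    "successively (\<lambda>x y. (x, y) \<in> R) xs"
proof -
  have "\<exists>xs. xs \<noteq> [] \<and> hd xs = u \<and> last xs = v \<and> distinct xs \<and> successively (\<lambda>x y. (x, y) \<in> R) xs"
    using assms
  proof (induction rule: converse_rtrancl_induct)
    case base
    show ?case by (intro exI[of _ "[v]"]) auto
  next
    case (step y z)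
    then obtain xs where xs: "xs \<noteq> []" "hd xs = z" "last xs = v" "distinct xs"
      "successively (\<lambda>x y. (x, y) \<in> R) xs" by blast
    show ?case
    proof (cases "y \<in> set xs")
      case True
      then obtain ys zs where "xs = ys @ y # zs" by (meson split_list)
      \<comment> \<open>Dropping everything before the earlier visit of \<open>y\<close> leaves a
        repetition-free path that starts at \<open>y\<close>.\<close>
      then show ?thesis using xs by (intro exI[of _ "y # zs"]) (auto simp: successively_append_iff)
    next
      case False
      then show ?thesis using xs step
        by (intro exI[of _ "y # xs"]) (auto simp: successively_Cons)
    qed
  qed
  then show thesis using that by blast
qed

text \<open>A repetition-free path from \<open>u\<close> to \<open>v\<close> that avoids the edge
  would be closed by it to a cycle.\<close>

lemma acyclic_edge_bridge:
  assumes nc: "\<nexists>xs. graph_cycle E xs" and e: "{u, v} \<in> E" and "u \<noteq> v"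
  shows "(u, v) \<notin> (adj (E - {{u, v}}))\<^sup>*"
proof
  assume "(u, v) \<in> (adj (E - {{u, v}}))\<^sup>*"
  then obtain xs where xs: "xs \<noteq> []" "hd xs = u" "last xs = v" "distinct xs"
    "successively (\<lambda>x y. (x, y) \<in> adj (E - {{u, v}})) xs"
    by (rule rtrancl_distinct_path)
  let ?n = "length xs"
  have st: "{xs ! i, xs ! Suc i} \<in> E - {{u, v}}" if "Suc i < ?n" for i
    using xs(5) that by (auto simp: successively_conv_nth adj_def)
  have u: "u = xs ! 0" and v: "v = xs ! (?n - 1)" using xs by (auto simp: hd_conv_nth last_conv_nth)
  have "?n \<noteq> 1" using u v \<open>u \<noteq> v\<close> by auto
  \<comment> \<open>A path with two vertices would consist of the removed edge itself.\<close>
  moreover have "?n \<noteq> 2" using u v st[of 0] by auto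
  ultimately have n: "3 \<le> ?n" using xs(1) by (cases xs; cases "tl xs"; cases "tl (tl xs)") auto
  have "{xs ! i, xs ! (Suc i mod ?n)} \<in> E" if i: "i < ?n" for i
  proof (cases "Suc i = ?n")
    case True
    then have "i = ?n - 1" by simp
    then have "xs ! i = v" "xs ! (Suc i mod ?n) = u" using True u v by simp_all
    then show ?thesis using e by (simp add: insert_commute)
  next
    case False
    then show ?thesis using i st[of i] by simp
  qed
  then have "graph_cycle E xs" using n xs by (auto simp: graph_cycle_def)
  then show False using nc by blast
qed

text \<open>The parent of \<open>v\<close> is the last vertex before \<open>v\<close> on a shortest
  walk from \<open>r\<close>, so the distance from \<open>r\<close> is a rank. The parent edges
  already connect \<open>V\<close>; a further edge of \<open>E\<close> would have its ends joined
  without it, which acyclicity forbids. The distance inequality is kept in the conclusion because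
  petioles are defined by distance.\<close>

lemma tree_graph_parent_map:
  assumes t: "tree_graph V E" and r: "r \<in> V"
  obtains p where "parent_map V r p" "parent_edges V r p = E"
    "\<And>v. v \<in> V - {r} \<Longrightarrow> graph_dist E r (p v) < graph_dist E r v"
proof -
  have conn: "connected_graph V E" and sg: "\<And>e. e \<in> E \<Longrightarrow> e \<subseteq> V \<and> card e = 2"
    and nc: "\<nexists>xs. graph_cycle E xs"
    using t by (auto simp: tree_graph_def sgraph_def)
  let ?d = "graph_dist E r"
  have "\<exists>w. {v, w} \<in> E \<and> ?d w < ?d v" if v: "v \<in> V - {r}" for v
  proof -
    have "(r, v) \<in> (adj E)\<^sup>*" using conn v r by (auto simp: connected_graph_def)
    then obtain m where "(r, v) \<in> adj E ^^ m" by (auto simp: rtrancl_power)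
    then have m: "(r, v) \<in> adj E ^^ ?d v" unfolding graph_dist_def by (rule LeastI)
    then obtain n where n: "?d v = Suc n" using v by (cases "?d v") auto
    then obtain w where w: "(r, w) \<in> adj E ^^ n" "(w, v) \<in> adj E" using m by auto
    then have "?d w \<le> n" unfolding graph_dist_def by (intro Least_le)
    then show ?thesis using w n by (auto simp: adj_def insert_commute intro!: exI[of _ w])
  qed
  then obtain p where p: "\<And>v. v \<in> V - {r} \<Longrightarrow> {v, p v} \<in> E \<and> ?d (p v) < ?d v" by metis
  have pm: "parent_map V r p"
    unfolding parent_map_def using r p sg by blast
  have sub: "parent_edges V r p \<subseteq> E" using p by (auto simp: parent_edges_def)
  have "e \<in> parent_edges V r p" if e: "e \<in> E" for e
  proof (rule ccontr)
    assume n: "e \<notin> parent_edges V r p"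
    obtain u v where uv: "e = {u, v}" "u \<noteq> v" "u \<in> V" "v \<in> V"
      using sg[OF e] by (auto simp: card_2_iff)
    have "(u, v) \<in> (adj (parent_edges V r p))\<^sup>*"
      using parent_map_connected[OF pm] uv by (meson adj_rtrancl_sym rtrancl_trans)
    moreover have "adj (parent_edges V r p) \<subseteq> adj (E - {e})" using sub n by (auto simp: adj_def)
    ultimately have "(u, v) \<in> (adj (E - {e}))\<^sup>*" using rtrancl_mono by blast
    then show False using acyclic_edge_bridge[OF nc, of u v] uv e by simp
  qed
  then show thesis using that[OF pm _ ] sub p by blast
qed

text \<open>If \<open>q\<close> read the edge \<open>{v, p v}\<close> the other way, then
  \<open>q (p v) = v\<close>; by induction \<open>p\<close> agrees with \<open>q\<close> at
  \<open>p v\<close>, so \<open>p\<close> would exchange \<open>v\<close> and \<open>p v\<close>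
  while lowering the rank twice.\<close>

lemma parent_map_unique:
  assumes p: "parent_map V r p" and q: "parent_map V r q"
    and eq: "parent_edges V r p = parent_edges V r q" and v: "v \<in> V - {r}"
  shows "p v = q v"
proof -
  from p obtain h :: "'a \<Rightarrow> nat" where h: "\<forall>v\<in>V - {r}. h (p v) < h v"
    by (auto simp: parent_map_def)
  show ?thesis using v
  proof (induction "h v" arbitrary: v rule: less_induct)
    case less
    have "{v, p v} \<in> parent_edges V r q" using less.prems parent_edgesI[of v V r p] eq by auto
    then consider "q v = p v" | "p v \<in> V - {r}" "q (p v) = v"
      using parent_edges_doubleton by metis
    then show ?case
    proof cases
      case 2
      have lt: "h (p v) < h v" using less.prems h by blast
      then have "p (p v) = v" using less.hyps 2 by metis
      moreover have "h (p (p v)) < h (p v)" using 2 h by blast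
      ultimately show ?thesis using lt by simp
    qed simp
  qed
qed

text \<open>The rank of \<open>p\<close> is arbitrary, but by uniqueness \<open>p\<close> coincides
  on \<open>V - {r}\<close> with the parent map built from distances. So any rank whatsoever gives
  information about distances.\<close>

lemma parent_map_dist_less:
  assumes "finite V" "parent_map V r p" "v \<in> V - {r}"
  shows "graph_dist (parent_edges V r p) r (p v) < graph_dist (parent_edges V r p) r v"
proof -
  have "r \<in> V" using assms(2) by (simp add: parent_map_def)
  then obtain q where "parent_map V r q" "parent_edges V r q = parent_edges V r p"
    "\<And>v. v \<in> V - {r} \<Longrightarrow>
       graph_dist (parent_edges V r p) r (q v) < graph_dist (parent_edges V r p) r v"
    using tree_graph_parent_map[OF parent_edges_tree_graph[OF assms(1,2)]] by metis
  then show ?thesis using parent_map_unique assms by metis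
qed

section \<open>Hollow hypertrees and petioles\<close>

text \<open>This describes the incidence tree rooted at the gap without mentioning graphs: the
  parent of an edge is \<open>pt e\<close>, and the parent of \<open>Some v\<close> is the only edge
  that contains it without having it as petiole. Given \<open>pt e \<in> e\<close> and
  \<open>I\<close> finite, \<open>e \<noteq> {pt e}\<close> is the cardinality bound on
  edges.\<close>

definition petiole_map ::
  "'a set \<Rightarrow> 'a option set set \<Rightarrow> ('a option set \<Rightarrow> 'a option) \<Rightarrow> bool" where
  "petiole_map I E pt \<longleftrightarrow>
     (\<forall>e\<in>E. e \<subseteq> with_gap I \<and> pt e \<in> e \<and> e \<noteq> {pt e} \<and> (None \<in> e \<longrightarrow> pt e = None)) \<and>
     (\<forall>v\<in>I. \<exists>!e. e \<in> E \<and> Some v \<in> e \<and> pt e \<noteq> Some v) \<and>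
     (\<exists>!e. e \<in> E \<and> None \<in> e) \<and>
     (\<exists>h::'a option \<Rightarrow> nat. \<forall>e\<in>E. \<forall>v\<in>e - {pt e}. h (pt e) < h v)"

text \<open>\<open>arg_min_on\<close> chooses among the minimisers, so the inequality is strict to
  leave only one.\<close>

lemma petiole_eqI:
  assumes "x \<in> e"
    and "\<And>v. v \<in> e \<Longrightarrow> v \<noteq> x \<Longrightarrow> graph_dist (incidence_edges E) (Inl None) (Inl x)
                          < graph_dist (incidence_edges E) (Inl None) (Inl v)"
  shows "petiole E e = x"
  unfolding petiole_def arg_min_on_def arg_min_def is_arg_min_def
proof (rule some_equality)
  show "x \<in> e \<and> (\<nexists>y. y \<in> e \<and> graph_dist (incidence_edges E) (Inl None) (Inl y)
      < graph_dist (incidence_edges E) (Inl None) (Inl x))"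
    using assms by (metis less_asym')
qed (use assms in metis)

lemma finite_with_gap: "finite I \<Longrightarrow> finite (with_gap I)"
  by (simp add: with_gap_def)

text \<open>In the incidence graph, edges go to their petioles and vertices to the edge in which
  they are not the petiole; this is a parent map with the gap as root. Two descents along it lead
  from any other vertex of an edge to the petiole, which is therefore nearer to the gap.\<close>

lemma petiole_map_hollow_hypertree:
  assumes fin: "finite I" and pt: "petiole_map I E pt"
  shows "hollow_hypertree I E" and "\<And>e. e \<in> E \<Longrightarrow> petiole E e = pt e"
proof -
  have e: "\<And>e. e \<in> E \<Longrightarrow> e \<subseteq> with_gap I \<and> pt e \<in> e \<and> e \<noteq> {pt e} \<and> (None \<in> e \<longrightarrow> pt e = None)"
    and bel: "\<And>v. v \<in> I \<Longrightarrow> \<exists>!e. e \<in> E \<and> Some v \<in> e \<and> pt e \<noteq> Some v"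
    and hol: "\<exists>!e. e \<in> E \<and> None \<in> e"
    using pt by (auto simp: petiole_map_def)
  from pt obtain h :: "'a option \<Rightarrow> nat" where h: "\<And>e v. e \<in> E \<Longrightarrow> v \<in> e - {pt e} \<Longrightarrow> h (pt e) < h v"
    unfolding petiole_map_def by metis
  have finE: "finite E" using e finite_with_gap[OF fin] by (meson Pow_iff finite_Pow_iff finite_subset subsetI)
  define below where "below v = (THE e. e \<in> E \<and> v \<in> e \<and> pt e \<noteq> v)" for v
  have below: "below (Some v) \<in> E \<and> Some v \<in> below (Some v) \<and> pt (below (Some v)) \<noteq> Some v"
    if "v \<in> I" for v
    unfolding below_def by (rule theI') (rule bel[OF that])
  have below_eq: "below v = x" if x: "x \<in> E" "v \<in> x" "v \<noteq> pt x" for x v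
  proof -
    obtain w where w: "v = Some w" "w \<in> I" using e[OF x(1)] x by (cases v) (auto simp: with_gap_def)
    show ?thesis using bel[OF w(2)] below[OF w(2)] x w by metis
  qed
  define P :: "'a option + 'a option set \<Rightarrow> 'a option + 'a option set"
    where "P = case_sum (\<lambda>v. Inr (below v)) (\<lambda>e. Inl (pt e))"
  have PS: "P (Inl v) = Inr (below v)" "P (Inr x) = Inl (pt x)" for v x by (simp_all add: P_def)
  let ?V = "incidence_verts (with_gap I) E"
  let ?r = "Inl None :: 'a option + 'a option set"
  have finV: "finite ?V" using finE finite_with_gap[OF fin] by (simp add: incidence_verts_def)
  have pm: "parent_map ?V ?r P"
    unfolding parent_map_def
  proof (intro conjI)
    show "?r \<in> ?V" by (auto simp: incidence_verts_def with_gap_def)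
    show "\<forall>v\<in>?V - {?r}. P v \<in> ?V"
      using e below by (fastforce simp: incidence_verts_def with_gap_def PS)
    show "\<exists>h::_ \<Rightarrow> nat. \<forall>v\<in>?V - {?r}. h (P v) < h v"
    proof (intro exI ballI)
      fix v assume v: "v \<in> ?V - {?r}"
      \<comment> \<open>Doubling \<open>h\<close> leaves the odd values for edges: an edge ranks
        just above its petiole and below its other vertices.\<close>
      show "case_sum (\<lambda>v. 2 * h v) (\<lambda>e. 2 * h (pt e) + 1) (P v)
          < case_sum (\<lambda>v. 2 * h v) (\<lambda>e. 2 * h (pt e) + 1) v"
      proof (cases v)
        case (Inl a)
        then obtain w where w: "a = Some w" "w \<in> I" using v by (auto simp: incidence_verts_def with_gap_def)
        then have "h (pt (below a)) < h a" using below[OF w(2)] by (intro h) auto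
        then show ?thesis using Inl by (simp add: PS)
      qed (simp add: PS)
    qed
  qed
  have ed: "parent_edges ?V ?r P = incidence_edges E"
  proof (intro set_eqI iffI)
    fix x assume "x \<in> parent_edges ?V ?r P"
    then obtain v where v: "v \<in> ?V - {?r}" "x = {v, P v}" by (auto simp: parent_edges_def)
    show "x \<in> incidence_edges E"
    proof (cases v)
      case (Inl a)
      then obtain w where w: "a = Some w" "w \<in> I" using v by (auto simp: incidence_verts_def with_gap_def)
      then show ?thesis using below[OF w(2)] v Inl by (auto simp: incidence_edges_def PS)
    next
      case (Inr a)
      then show ?thesis using v e[of a] by (auto simp: incidence_edges_def incidence_verts_def PS)
    qed
  next
    fix x assume "x \<in> incidence_edges E"
    then obtain v a where va: "x = {Inl v, Inr a}" "a \<in> E" "v \<in> a" by (auto simp: incidence_edges_def)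
    show "x \<in> parent_edges ?V ?r P"
    proof (cases "v = pt a")
      case True
      then have "x = {Inr a, P (Inr a)}" using va by (simp add: PS insert_commute)
      then show ?thesis using va parent_edgesI[of "Inr a" ?V ?r P] by (auto simp: incidence_verts_def)
    next
      case False
      then have "x = {Inl v, P (Inl v)}" using va below_eq[of a v] by (simp add: PS)
      moreover have "v \<noteq> None" "v \<in> with_gap I" using False e va by auto
      ultimately show ?thesis using va parent_edgesI[of "Inl v" ?V ?r P] by (auto simp: incidence_verts_def)
    qed
  qed
  have "2 \<le> card x" if x: "x \<in> E" for x
  proof -
    obtain y where "y \<in> x" "y \<noteq> pt x" using e[OF x] by auto
    then have "card {y, pt x} \<le> card x" using e[OF x] finite_with_gap[OF fin]
      by (intro card_mono) (auto intro: finite_subset)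
    then show ?thesis using \<open>y \<noteq> pt x\<close> by simp
  qed
  then have "hypergraph (with_gap I) E" using e finite_with_gap[OF fin] by (auto simp: hypergraph_def)
  then show "hollow_hypertree I E"
    using parent_edges_tree_graph[OF finV pm] hol unfolding ed
    by (auto simp: hollow_hypertree_def hypertree_def with_gap_def)
  fix x assume x: "x \<in> E"
  let ?d = "graph_dist (incidence_edges E) ?r"
  show "petiole E x = pt x"
  proof (rule petiole_eqI)
    fix v assume v: "v \<in> x" "v \<noteq> pt x"
    have "v \<noteq> None" "v \<in> with_gap I" using e[OF x] v by (metis, blast)
    then have "Inl v \<in> ?V - {?r}" "Inr x \<in> ?V - {?r}" using x by (auto simp: incidence_verts_def)
    then have "?d (P (Inl v)) < ?d (Inl v)" "?d (P (Inr x)) < ?d (Inr x)"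
      using parent_map_dist_less[OF finV pm] unfolding ed by blast+
    then show "?d (Inl (pt x)) < ?d (Inl v)" using below_eq[OF x v] by (simp add: PS)
  qed (use e x in auto)
qed

text \<open>Root the incidence tree at the gap. It is bipartite, so the parent of an edge is one of
  its vertices; every other vertex of the edge has that edge as parent and lies further from the
  gap. So the parent of an edge is its petiole, and the distance from the gap is the rank.\<close>

lemma hollow_hypertree_petiole_map:
  assumes hh: "hollow_hypertree I E"
  shows "petiole_map I E (petiole E)"
proof -
  let ?V = "incidence_verts (with_gap I) E"
  let ?r = "Inl None :: 'a option + 'a option set"
  let ?d = "graph_dist (incidence_edges E) ?r"
  have t: "tree_graph ?V (incidence_edges E)" and hol: "\<exists>!e. e \<in> E \<and> None \<in> e"
    and sub: "\<And>e. e \<in> E \<Longrightarrow> e \<subseteq> with_gap I \<and> 2 \<le> card e"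
    using hh by (auto simp: hollow_hypertree_def hypertree_def hypergraph_def)
  have "?r \<in> ?V" by (auto simp: incidence_verts_def with_gap_def)
  then obtain P where pm: "parent_map ?V ?r P" and ed: "parent_edges ?V ?r P = incidence_edges E"
    and d: "\<And>v. v \<in> ?V - {?r} \<Longrightarrow> ?d (P v) < ?d v"
    using tree_graph_parent_map[OF t] by metis
  have inc: "{a, b} \<in> incidence_edges E \<longleftrightarrow>
      (\<exists>v e. e \<in> E \<and> v \<in> e \<and> (a = Inl v \<and> b = Inr e \<or> a = Inr e \<and> b = Inl v))" for a b
    by (fastforce simp: incidence_edges_def doubleton_eq_iff)
  have Pe: "\<exists>v. P (Inr e) = Inl v \<and> v \<in> e" if "e \<in> E" for e
  proof -
    have "{Inr e, P (Inr e)} \<in> incidence_edges E"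
      unfolding ed[symmetric] using that by (intro parent_edgesI) (auto simp: incidence_verts_def)
    then show ?thesis by (auto simp: inc)
  qed
  have Pv: "\<exists>e\<in>E. P (Inl (Some v)) = Inr e \<and> Some v \<in> e" if "v \<in> I" for v
  proof -
    have "{Inl (Some v), P (Inl (Some v))} \<in> incidence_edges E"
      unfolding ed[symmetric] using that
      by (intro parent_edgesI) (auto simp: incidence_verts_def with_gap_def)
    then show ?thesis by (auto simp: inc)
  qed
  \<comment> \<open>An incidence is a parent edge, read from the vertex or from the hyperedge; the
    first is impossible for the gap, which is the root.\<close>
  have inc_cases: "v \<noteq> None \<and> P (Inl v) = Inr e \<or> P (Inr e) = Inl v" if "e \<in> E" "v \<in> e" for e v
  proof -
    have "{Inl v, Inr e} \<in> parent_edges ?V ?r P" using that by (auto simp: ed inc)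
    then show ?thesis using parent_edges_doubleton by fastforce
  qed
  have dless: "?d (Inl x) < ?d (Inl v)"
    if "e \<in> E" "P (Inr e) = Inl x" "v \<in> e" "v \<noteq> x" for e x v
  proof -
    have "v \<noteq> None" "P (Inl v) = Inr e" using inc_cases that by force+
    moreover have "Inl v \<in> ?V" "Inr e \<in> ?V" using that sub by (auto simp: incidence_verts_def)
    ultimately show ?thesis using d[of "Inl v"] d[of "Inr e"] that by auto
  qed
  have pet: "P (Inr e) = Inl (petiole E e) \<and> petiole E e \<in> e" if e: "e \<in> E" for e
  proof -
    obtain x where x: "P (Inr e) = Inl x" "x \<in> e" using Pe e by blast
    then have "petiole E e = x" using dless e by (intro petiole_eqI) blast+
    then show ?thesis using x by simp
  qed
  show ?thesis
    unfolding petiole_map_def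
  proof (intro conjI ballI)
    fix e assume e: "e \<in> E"
    show "e \<subseteq> with_gap I" "petiole E e \<in> e" using sub pet e by auto
    show "e \<noteq> {petiole E e}"
    proof
      assume "e = {petiole E e}"
      then have "card e = 1" by (metis is_singletonI is_singleton_altdef)
      then show False using sub[OF e] by simp
    qed
    show "None \<in> e \<longrightarrow> petiole E e = None" using inc_cases pet e by force
  next
    fix v assume v: "v \<in> I"
    obtain e where e: "e \<in> E" "P (Inl (Some v)) = Inr e" "Some v \<in> e" using Pv v by blast
    show "\<exists>!e. e \<in> E \<and> Some v \<in> e \<and> petiole E e \<noteq> Some v"
    proof (rule ex1I)
      have "Inl (Some v) \<in> ?V" "Inr e \<in> ?V"
        using v e by (auto simp: incidence_verts_def with_gap_def)
      then have "?d (Inr e) < ?d (Inl (Some v))" "?d (P (Inr e)) < ?d (Inr e)"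
        using d[of "Inl (Some v)"] d[of "Inr e"] e by auto
      then show "e \<in> E \<and> Some v \<in> e \<and> petiole E e \<noteq> Some v" using e pet[of e] by auto
    next
      fix e' assume "e' \<in> E \<and> Some v \<in> e' \<and> petiole E e' \<noteq> Some v"
      then show "e' = e" using inc_cases[of e' "Some v"] pet[of e'] e by auto
    qed
  next
    show "\<exists>!e. e \<in> E \<and> None \<in> e" by (rule hol)
  next
    show "\<exists>h::'a option \<Rightarrow> nat. \<forall>e\<in>E. \<forall>v\<in>e - {petiole E e}. h (petiole E e) < h v"
      using dless pet by (intro exI[of _ "\<lambda>v. ?d (Inl v)"]) blast
  qed
qed

section \<open>Transport of species along natural bijections\<close>

text \<open>Every structure of \<open>G\<close> is the image of one of \<open>F\<close>, and
  naturality turns each functor law for \<open>G\<close> into the same law for \<open>F\<close>.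
  Thus \<open>species G\<close> is a by-product of the bijection.\<close>

lemma species_isomorphicI:
  fixes F :: "('a, 's) species_data" and G :: "('a, 't) species_data"
  assumes F: "species F"
    and bij: "\<And>I. finite I \<Longrightarrow> bij_betw (\<phi> I) (struct F I) (struct G I)"
    and nat: "\<And>I J f s. finite I \<Longrightarrow> bij_betw f I J \<Longrightarrow> s \<in> struct F I \<Longrightarrow>
                \<phi> J (transp F I f s) = transp G I f (\<phi> I s)"
  shows "species_isomorphic F G"
proof -
  interpret F: species F by (rule F)
  have lift: "\<exists>s\<in>struct F I. t = \<phi> I s" if "finite I" "t \<in> struct G I" for I t
    using bij[OF that(1)] that(2) by (auto simp: bij_betw_def)
  have mem: "\<phi> I s \<in> struct G I" if "finite I" "s \<in> struct F I" for I s
    using bij that by (auto simp: bij_betw_def)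
  have finJ: "finite J" if "finite I" "bij_betw f I J" for I J :: "'a set" and f
    using that bij_betw_finite by blast
  have "species G"
  proof
    fix I :: "'a set" assume "finite I"
    then show "finite (struct G I)" using bij F.finite_struct bij_betw_finite by blast
  next
    fix I J :: "'a set" and f t assume a: "finite I" "bij_betw f I J" "t \<in> struct G I"
    then obtain s where "s \<in> struct F I" "t = \<phi> I s" using lift by blast
    then show "transp G I f t \<in> struct G J"
      using nat[OF a(1,2)] mem[OF finJ[OF a(1,2)] F.transp_closed[OF a(1,2)]] by simp
  next
    fix I J :: "'a set" and f g t
    assume a: "finite I" "bij_betw f I J" "\<And>x. x \<in> I \<Longrightarrow> f x = g x" "t \<in> struct G I"
    then obtain s where s: "s \<in> struct F I" "t = \<phi> I s" using lift by blast
    have g: "bij_betw g I J" using a(2) bij_betw_cong[of I f g J] a(3) by simp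
    show "transp G I f t = transp G I g t"
      using nat[OF a(1,2) s(1)] nat[OF a(1) g s(1)] F.transp_cong[OF a(1,2,3) s(1)] s(2) by simp
  next
    fix I :: "'a set" and t assume a: "finite I" "t \<in> struct G I"
    then obtain s where s: "s \<in> struct F I" "t = \<phi> I s" using lift by blast
    show "transp G I id t = t"
      using nat[OF a(1) bij_betw_id s(1)] F.transp_id[OF a(1) s(1)] s(2) by simp
  next
    fix I J K :: "'a set" and f g t
    assume a: "finite I" "bij_betw f I J" "bij_betw g J K" "t \<in> struct G I"
    then obtain s where s: "s \<in> struct F I" "t = \<phi> I s" using lift by blast
    show "transp G I (g \<circ> f) t = transp G J g (transp G I f t)"
      using nat[OF a(1) bij_betw_trans[OF a(2,3)] s(1)] nat[OF a(1,2) s(1)]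
        nat[OF finJ[OF a(1,2)] a(3) F.transp_closed[OF a(1,2) s(1)]]
        F.transp_comp[OF a(1-3) s(1)] s(2) by simp
  qed
  then show ?thesis using F bij nat unfolding species_isomorphic_def
    by (intro conjI exI[of _ \<phi>]) auto
qed

lemma species_isomorphicE:
  fixes F :: "('a, 's) species_data" and G :: "('a, 't) species_data"
  assumes "species_isomorphic F G"
  obtains \<phi> where "species F" "species G"
    "\<And>I. finite I \<Longrightarrow> bij_betw (\<phi> I) (struct F I) (struct G I)"
    "\<And>I J f s. finite I \<Longrightarrow> bij_betw f I J \<Longrightarrow> s \<in> struct F I \<Longrightarrow>
       \<phi> J (transp F I f s) = transp G I f (\<phi> I s)"
proof -
  note iso = assms[unfolded species_isomorphic_def]
  from iso[THEN conjunct2, THEN conjunct2] obtain \<phi> where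
    \<phi>: "(\<forall>I. finite I \<longrightarrow> bij_betw (\<phi> I) (struct F I) (struct G I)) \<and>
          (\<forall>I J f. finite I \<longrightarrow> bij_betw f I J \<longrightarrow>
             (\<forall>s\<in>struct F I. \<phi> J (transp F I f s) = transp G I f (\<phi> I s)))" ..
  show thesis
    by (rule that[of \<phi>]) (simp_all add: iso \<phi>)
qed

lemma species_isomorphic_sym:
  fixes F :: "('a, 's) species_data" and G :: "('a, 't) species_data"
  assumes "species_isomorphic F G"
  shows "species_isomorphic G F"
proof -
  from assms obtain \<phi> where F: "species F" and G: "species G"
    and bij: "\<And>I. finite I \<Longrightarrow> bij_betw (\<phi> I) (struct F I) (struct G I)"
    and nat: "\<And>I J f s. finite I \<Longrightarrow> bij_betw f I J \<Longrightarrow> s \<in> struct F I \<Longrightarrow>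
                \<phi> J (transp F I f s) = transp G I f (\<phi> I s)"
    by (rule species_isomorphicE) blast
  let ?\<psi> = "\<lambda>I. inv_into (struct F I) (\<phi> I)"
  show ?thesis
  proof (rule species_isomorphicI[OF G, of ?\<psi>])
    show "bij_betw (?\<psi> I) (struct G I) (struct F I)" if "finite I" for I
      using bij[OF that] by (rule bij_betw_inv_into)
    fix I J :: "'a set" and f t assume a: "finite I" "bij_betw f I J" "t \<in> struct G I"
    then have s: "?\<psi> I t \<in> struct F I" "\<phi> I (?\<psi> I t) = t"
      using bij[OF a(1)] by (auto simp: bij_betw_def inv_into_into f_inv_into_f)
    have "finite J" using a bij_betw_finite by blast
    then have "inj_on (\<phi> J) (struct F J)" using bij by (auto simp: bij_betw_def)
    then show "?\<psi> J (transp G I f t) = transp F I f (?\<psi> I t)"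
      using nat[OF a(1,2) s(1)] s(2) inv_into_f_f[OF _ species.transp_closed[OF F a(1,2) s(1)]]
      by metis
  qed
qed

lemma species_isomorphic_trans:
  fixes F :: "('a, 's) species_data" and G :: "('a, 't) species_data"
    and H :: "('a, 'u) species_data"
  assumes "species_isomorphic F G" "species_isomorphic G H"
  shows "species_isomorphic F H"
proof -
  from assms(1) obtain \<phi> where F: "species F"
    and bij1: "\<And>I. finite I \<Longrightarrow> bij_betw (\<phi> I) (struct F I) (struct G I)"
    and nat1: "\<And>I J f s. finite I \<Longrightarrow> bij_betw f I J \<Longrightarrow> s \<in> struct F I \<Longrightarrow>
                \<phi> J (transp F I f s) = transp G I f (\<phi> I s)"
    by (rule species_isomorphicE) blast
  from assms(2) obtain \<psi> where
    bij2: "\<And>I. finite I \<Longrightarrow> bij_betw (\<psi> I) (struct G I) (struct H I)"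
    and nat2: "\<And>I J f s. finite I \<Longrightarrow> bij_betw f I J \<Longrightarrow> s \<in> struct G I \<Longrightarrow>
                \<psi> J (transp G I f s) = transp H I f (\<psi> I s)"
    by (rule species_isomorphicE) blast
  show ?thesis
  proof (rule species_isomorphicI[OF F, of "\<lambda>I. \<psi> I \<circ> \<phi> I"])
    fix I J :: "'a set" and f s assume a: "finite I" "bij_betw f I J" "s \<in> struct F I"
    then have "\<phi> I s \<in> struct G I" using bij1[OF a(1)] by (auto simp: bij_betw_def)
    then show "(\<psi> J \<circ> \<phi> J) (transp F I f s) = transp H I f ((\<psi> I \<circ> \<phi> I) s)"
      using nat1[OF a] nat2[OF a(1,2)] by simp
  next
    show "bij_betw (\<psi> I \<circ> \<phi> I) (struct F I) (struct H I)" if "finite I" for I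
      using bij_betw_trans[OF bij1[OF that] bij2[OF that]] .
  qed
qed

section \<open>Parent maps with marked vertices\<close>

text \<open>
  The intermediate species: \<open>p\<close> sends each vertex to its parent and the root to the gap, and \<open>T\<close>
  consists of the root and of the vertices joined to their parent by an edge of colour 1.
\<close>

locale marked_parent_map =
  fixes I :: "'a set" and p :: "'a \<Rightarrow> 'a option" and T :: "'a set"
  assumes p_closed: "p \<in> I \<rightarrow>\<^sub>E with_gap I"
    and T_sub: "T \<subseteq> I"
    and root_in_T: "\<And>v. v \<in> I \<Longrightarrow> p v = None \<Longrightarrow> v \<in> T"
    and root_unique: "\<exists>!r. r \<in> I \<and> p r = None"
    and rank_ex: "\<exists>h::'a option \<Rightarrow> nat. \<forall>v\<in>I. h (p v) < h (Some v)"
begin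

definition root :: 'a where "root = (THE r. r \<in> I \<and> p r = None)"

lemma root: "root \<in> I" "p root = None" "root \<in> T"
  using theI'[OF root_unique] root_in_T unfolding root_def by auto

lemma root_eq: "v \<in> I \<Longrightarrow> p v = None \<Longrightarrow> v = root"
  using root_unique root by blast

lemma p_SomeD: "v \<in> I \<Longrightarrow> p v = Some w \<Longrightarrow> w \<in> I"
  using PiE_mem[OF p_closed, of v] by (auto simp: with_gap_def)

lemma p_Some: "v \<in> I \<Longrightarrow> v \<noteq> root \<Longrightarrow> \<exists>w\<in>I. p v = Some w"
  using p_SomeD root_eq by (cases "p v") auto

text \<open>Only the root has the gap as parent, so \<open>the\<close> is harmless elsewhere, and a
  rank restricts along \<open>Some\<close>.\<close>

lemma parent_map_root: "parent_map I root (the \<circ> p)"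
proof -
  obtain h :: "'a option \<Rightarrow> nat" where "\<forall>v\<in>I. h (p v) < h (Some v)" using rank_ex by blast
  then have "\<forall>v\<in>I - {root}. h (Some (the (p v))) < h (Some v)" using p_Some by fastforce
  moreover have "\<forall>v\<in>I - {root}. the (p v) \<in> I" using p_Some by fastforce
  ultimately show ?thesis unfolding parent_map_def using root(1)
    by (intro conjI exI[of _ "\<lambda>v. h (Some v)"]) auto
qed

end

definition marked_parent_maps :: "('a, ('a \<Rightarrow> 'a option) \<times> 'a set) species_data" where
  "marked_parent_maps =
     \<lparr> struct = (\<lambda>I. {(p, T). marked_parent_map I p T}),
       transp = (\<lambda>I f (p, T). (\<lambda>w\<in>f ` I. map_option f (p (inv_into I f w)), f ` T)) \<rparr>"

text \<open>\<open>f\<close> conjugates \<open>p\<close>, and the rank is pulled back along the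
  inverse of \<open>f\<close>, extended to fix the gap.\<close>

lemma marked_parent_map_transp:
  assumes m: "marked_parent_map I p T" and inj: "inj_on f I"
  shows "marked_parent_map (f ` I) (\<lambda>w\<in>f ` I. map_option f (p (inv_into I f w))) (f ` T)"
    (is "marked_parent_map _ ?p _")
proof -
  interpret marked_parent_map I p T by (rule m)
  have p: "?p (f v) = map_option f (p v)" if "v \<in> I" for v using inj that by simp
  show ?thesis
  proof
    have "map_option f (p v) \<in> with_gap (f ` I)" if "v \<in> I" for v
      using p_SomeD[OF that] by (cases "p v") (auto simp: with_gap_def)
    then show "?p \<in> f ` I \<rightarrow>\<^sub>E with_gap (f ` I)" using inj by auto
    show "f ` T \<subseteq> f ` I" using T_sub by auto
    show "w \<in> f ` T" if w: "w \<in> f ` I" "?p w = None" for w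
    proof -
      obtain v where v: "v \<in> I" "w = f v" using w by auto
      then have "p v = None" using w p[OF v(1)] by simp
      then show ?thesis using root_in_T v by blast
    qed
    show "\<exists>!r. r \<in> f ` I \<and> ?p r = None"
    proof (rule ex1I)
      show "f root \<in> f ` I \<and> ?p (f root) = None" using root p[OF root(1)] by simp
      fix w assume w: "w \<in> f ` I \<and> ?p w = None"
      then obtain v where v: "v \<in> I" "w = f v" by auto
      then have "p v = None" using w p[OF v(1)] by simp
      then show "w = f root" using root_eq v by blast
    qed
    obtain h :: "'a option \<Rightarrow> nat" where h: "\<forall>v\<in>I. h (p v) < h (Some v)" using rank_ex by blast
    have inv: "map_option (inv_into I f) (map_option f x) = x" if "x \<in> with_gap I" for x
      using that inj by (auto simp: with_gap_def)
    have "h (map_option (inv_into I f) (?p w)) < h (map_option (inv_into I f) (Some w))"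
      if w: "w \<in> f ` I" for w
    proof -
      obtain v where v: "v \<in> I" "w = f v" using w by auto
      moreover have "p v \<in> with_gap I" using p_closed v by auto
      ultimately show ?thesis using h p[OF v(1)] inv inj by (simp del: option.map_comp)
    qed
    then show "\<exists>h::_ \<Rightarrow> nat. \<forall>w\<in>f ` I. h (?p w) < h (Some w)"
      by (intro exI[of _ "\<lambda>x. h (map_option (inv_into I f) x)"]) blast
  qed
qed

lemma species_marked_parent_maps: "species (marked_parent_maps :: ('a, _) species_data)"
proof
  fix I :: "'a set" assume I: "finite I"
  have "struct marked_parent_maps I \<subseteq> (I \<rightarrow>\<^sub>E with_gap I) \<times> Pow I"
    by (auto simp: marked_parent_maps_def marked_parent_map_def)
  moreover have "finite ((I \<rightarrow>\<^sub>E with_gap I) \<times> Pow I)"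
    using I by (intro finite_cartesian_product finite_PiE) (auto simp: finite_with_gap)
  ultimately show "finite (struct marked_parent_maps I)" by (rule finite_subset)
next
  fix I J :: "'a set" and f s
  assume "finite I" "bij_betw f I J" "s \<in> struct marked_parent_maps I"
  then show "transp marked_parent_maps I f s \<in> struct marked_parent_maps J"
    using marked_parent_map_transp[of I _ _ f]
    by (auto simp: marked_parent_maps_def bij_betw_def simp del: restrict_apply)
next
  fix I J :: "'a set" and f g and s :: "('a \<Rightarrow> 'a option) \<times> 'a set"
  assume b: "bij_betw f I J" and fg: "\<And>x. x \<in> I \<Longrightarrow> f x = g x"
    and "s \<in> struct marked_parent_maps I"
  then obtain p T where s: "s = (p, T)" "marked_parent_map I p T"
    by (auto simp: marked_parent_maps_def)
  interpret marked_parent_map I p T by (rule s)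
  have im: "f ` I = g ` I" "f ` T = g ` T" using fg T_sub by (auto intro!: image_cong)
  \<comment> \<open>\<open>inv_into\<close> looks at \<open>f\<close> only on \<open>I\<close>, so
    this holds for \<open>w\<close> outside the image too.\<close>
  have "inv_into I f w = inv_into I g w" for w
  proof -
    have "(\<lambda>x. x \<in> I \<and> f x = w) = (\<lambda>x. x \<in> I \<and> g x = w)" using fg by auto
    then show ?thesis by (simp add: inv_into_def)
  qed
  moreover have "map_option f (p v) = map_option g (p v)" if "v \<in> I" for v
    using p_SomeD[OF that] fg by (cases "p v") auto
  ultimately have "(\<lambda>w\<in>f ` I. map_option f (p (inv_into I f w)))
      = (\<lambda>w\<in>g ` I. map_option g (p (inv_into I g w)))"
    unfolding im by (intro restrict_ext) (simp add: inv_into_into)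
  then show "transp marked_parent_maps I f s = transp marked_parent_maps I g s"
    using im by (simp add: marked_parent_maps_def s)
next
  fix I :: "'a set" and s :: "('a \<Rightarrow> 'a option) \<times> 'a set"
  assume "s \<in> struct marked_parent_maps I"
  then obtain p T where s: "s = (p, T)" "marked_parent_map I p T"
    by (auto simp: marked_parent_maps_def)
  interpret marked_parent_map I p T by (rule s)
  have "(\<lambda>w\<in>I. p (inv_into I id w)) = p"
  proof (rule extensionalityI[of _ I])
    show "p \<in> extensional I" using p_closed by (simp add: PiE_def)
    show "(\<lambda>w\<in>I. p (inv_into I id w)) v = p v" if "v \<in> I" for v
      using that inv_into_f_f[of id I v] by simp
  qed simp
  then show "transp marked_parent_maps I id s = s"
    by (simp add: marked_parent_maps_def s option.map_id)
next
  fix I J K :: "'a set" and f g and s :: "('a \<Rightarrow> 'a option) \<times> 'a set"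
  assume f: "bij_betw f I J" and g: "bij_betw g J K" and "s \<in> struct marked_parent_maps I"
  then obtain p T where s: "s = (p, T)" "marked_parent_map I p T"
    by (auto simp: marked_parent_maps_def)
  have im: "f ` I = J" "(g \<circ> f) ` I = K" "g ` J = K" and inj: "inj_on f I" "inj_on g J" "inj_on (g \<circ> f) I"
    using f g bij_betw_trans[OF f g] by (auto simp: bij_betw_def)
  have "(\<lambda>w\<in>K. map_option (g \<circ> f) (p (inv_into I (g \<circ> f) w)))
      = (\<lambda>w\<in>K. map_option g ((\<lambda>w\<in>J. map_option f (p (inv_into I f w))) (inv_into J g w)))"
  proof (rule restrict_ext)
    fix w assume "w \<in> K"
    then obtain v where v: "v \<in> I" "w = (g \<circ> f) v" using im by blast
    then have "inv_into I (g \<circ> f) w = v" "inv_into J g w = f v" "inv_into I f (f v) = v" "f v \<in> J"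
      using inj im by (auto intro!: inv_into_f_eq)
    then show "map_option (g \<circ> f) (p (inv_into I (g \<circ> f) w))
        = map_option g ((\<lambda>w\<in>J. map_option f (p (inv_into I f w))) (inv_into J g w))"
      by (simp add: option.map_comp)
  qed
  then show "transp marked_parent_maps I (g \<circ> f) s
      = transp marked_parent_maps J g (transp marked_parent_maps I f s)"
    using im(2) by (simp add: marked_parent_maps_def s im(1,3) image_comp o_def)
qed

section \<open>Two-coloured rooted trees as marked parent maps\<close>

text \<open>Two vertices with the same parent edge would be each other's parents. Hence an edge
  determines its child end, and colours of edges amount to marks on the vertices other than the
  root.\<close>

lemma inj_on_parent_edge:
  assumes "parent_map V r p"
  shows "inj_on (\<lambda>v. {v, p v}) (V - {r})"
proof (rule inj_onI)
  fix v w assume vw: "v \<in> V - {r}" "w \<in> V - {r}" "{v, p v} = {w, p w}"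
  obtain h :: "'a \<Rightarrow> nat" where h: "\<forall>v\<in>V - {r}. h (p v) < h v"
    using assms by (auto simp: parent_map_def)
  show "v = w"
  proof (rule ccontr)
    assume "v \<noteq> w"
    then have "p v = w" "p w = v" using vw(3) by (auto simp: doubleton_eq_iff)
    then show False using h vw by (metis less_asym')
  qed
qed

text \<open>An edge as a set does not show which end is the child, so its colour is given by an
  existential over marked vertices; \<open>r\<close> is left out because its mark stands for no
  edge.\<close>

definition coloured_tree ::
  "'a set \<Rightarrow> ('a \<Rightarrow> 'a option) \<times> 'a set \<Rightarrow> 'a coloured_rtree" where
  "coloured_tree I = (\<lambda>(p, T). let r = marked_parent_map.root I p; E = parent_edges I r (the \<circ> p) in
     ((r, E), \<lambda>e\<in>E. of_bool (\<exists>v\<in>T - {r}. e = {v, the (p v)})))"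

context marked_parent_map
begin

lemma colour_eq:
  assumes "v \<in> I" "v \<noteq> root"
  shows "(\<exists>u\<in>T - {root}. {v, the (p v)} = {u, the (p u)}) \<longleftrightarrow> v \<in> T"
proof
  assume "\<exists>u\<in>T - {root}. {v, the (p v)} = {u, the (p u)}"
  then obtain u where u: "u \<in> T - {root}" "{v, the (p v)} = {u, the (p u)}" by blast
  then have "v = u" using inj_onD[OF inj_on_parent_edge[OF parent_map_root], of v u] assms T_sub by auto
  then show "v \<in> T" using u by simp
qed (use assms in blast)

lemma coloured_tree_in:
  assumes "finite I"
  shows "coloured_tree I (p, T) \<in> struct two_coloured_rooted_trees I"
  using parent_edges_tree_graph[OF assms parent_map_root] root
  by (auto simp: coloured_tree_def Let_def two_coloured_rooted_trees_def rooted_trees_def)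

end

text \<open>Away from the root, the edges determine the parents and the colours determine the marks;
  at the root both are forced.\<close>

lemma coloured_tree_inj:
  assumes m: "marked_parent_map I p T" "marked_parent_map I p' T'"
    and eq: "coloured_tree I (p, T) = coloured_tree I (p', T')"
  shows "p = p' \<and> T = T'"
proof -
  interpret M: marked_parent_map I p T by (rule m)
  interpret M': marked_parent_map I p' T' by (rule m)
  let ?E = "parent_edges I M.root (the \<circ> p)"
  note eqs = eq[unfolded coloured_tree_def Let_def prod.case prod.inject]
  have r: "M'.root = M.root" using eqs[THEN conjunct1, THEN conjunct1] by (rule sym)
  have E: "parent_edges I M.root (the \<circ> p') = ?E"
    using eqs[THEN conjunct1, THEN conjunct2] by (simp only: r)
  have c: "(\<lambda>e\<in>?E. of_bool (\<exists>v\<in>T - {M.root}. e = {v, the (p v)}) :: nat)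
      = (\<lambda>e\<in>?E. of_bool (\<exists>v\<in>T' - {M.root}. e = {v, the (p' v)}))"
    using eqs[THEN conjunct2] by (simp only: r E)
  have the: "the (p v) = the (p' v)" if "v \<in> I" "v \<noteq> M.root" for v
    using parent_map_unique[OF M.parent_map_root M'.parent_map_root[unfolded r]] E that by simp
  have "p v = p' v" if v: "v \<in> I" for v
  proof (cases "v = M.root")
    case True
    then show ?thesis using M.root M'.root r by simp
  next
    case False
    then show ?thesis using M.p_Some[OF v] M'.p_Some[OF v] r the[OF v] by force
  qed
  then have "p = p'" using M.p_closed M'.p_closed by (intro PiE_ext) auto
  moreover have "v \<in> T \<longleftrightarrow> v \<in> T'" if v: "v \<in> I" for v
  proof (cases "v = M.root")
    case True
    then show ?thesis using M.root M'.root r by simp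
  next
    case False
    then have e: "{v, the (p v)} \<in> ?E" using v parent_edgesI[of v I M.root "the \<circ> p"] by simp
    have "of_bool (\<exists>u\<in>T - {M.root}. {v, the (p v)} = {u, the (p u)})
        = (of_bool (\<exists>u\<in>T' - {M.root}. {v, the (p v)} = {u, the (p' u)}) :: nat)"
      using fun_cong[OF c, of "{v, the (p v)}"] by (simp only: restrict_apply' e)
    then show ?thesis
      unfolding of_bool_eq_iff
      using M.colour_eq[OF v False] M'.colour_eq[OF v, unfolded r, OF False]
      by (simp only: the[OF v False])
  qed
  ultimately show ?thesis using M.T_sub M'.T_sub by blast
qed

lemma coloured_tree_surj:
  assumes I: "finite I" and s: "s \<in> struct two_coloured_rooted_trees I"
  obtains p T where "marked_parent_map I p T" "coloured_tree I (p, T) = s"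
proof -
  obtain r E c where sc: "s = ((r, E), c)" and r: "r \<in> I" and t: "tree_graph I E"
    and c: "c \<in> E \<rightarrow>\<^sub>E {0, 1}"
    using s by (auto simp: two_coloured_rooted_trees_def rooted_trees_def)
  obtain q where q: "parent_map I r q" "parent_edges I r q = E"
    using tree_graph_parent_map[OF t r] by metis
  define p where "p = (\<lambda>v\<in>I. if v = r then None else Some (q v))"
  \<comment> \<open>The colour of the edge to the parent becomes the mark; the root has no such edge
    and is marked by convention.\<close>
  define T where "T = {v\<in>I. v = r \<or> c {v, q v} = 1}"
  have pr: "p r = None" and pq: "\<And>v. v \<in> I \<Longrightarrow> v \<noteq> r \<Longrightarrow> p v = Some (q v)"
    using r by (auto simp: p_def)
  have m: "marked_parent_map I p T"
  proof
    show "p \<in> I \<rightarrow>\<^sub>E with_gap I" using q(1) by (auto simp: p_def with_gap_def parent_map_def)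
    show "T \<subseteq> I" by (auto simp: T_def)
    show "v \<in> T" if "v \<in> I" "p v = None" for v
      using that pq[of v] by (cases "v = r") (auto simp: T_def)
    show "\<exists>!r. r \<in> I \<and> p r = None" using r pr pq by (intro ex1I[of _ r]) (blast, fastforce)
    obtain h :: "'a \<Rightarrow> nat" where h: "\<forall>v\<in>I - {r}. h (q v) < h v"
      using q(1) by (auto simp: parent_map_def)
    show "\<exists>h::'a option \<Rightarrow> nat. \<forall>v\<in>I. h (p v) < h (Some v)"
    proof (intro exI ballI)
      fix v assume "v \<in> I"
      \<comment> \<open>The gap gets rank 0 and the ranks in \<open>I\<close> are shifted by one, so
        that the root too lies above its parent.\<close>
      then show "case_option 0 (\<lambda>v. Suc (h v)) (p v) < case_option 0 (\<lambda>v. Suc (h v)) (Some v)"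
        using h pr pq by (cases "v = r") auto
    qed
  qed
  interpret marked_parent_map I p T by (rule m)
  have root: "root = r" using root_eq[OF r pr] by simp
  have E: "parent_edges I r (the \<circ> p) = E"
    unfolding q(2)[symmetric] parent_edges_def using pq by (intro image_cong) auto
  have "(\<lambda>e\<in>E. of_bool (\<exists>v\<in>T - {r}. e = {v, the (p v)})) = c"
  proof (rule extensionalityI[of _ E])
    fix e assume e: "e \<in> E"
    then obtain v where v: "v \<in> I" "v \<noteq> r" "e = {v, q v}"
      using q(2) by (auto simp: parent_edges_def)
    then have "(\<exists>u\<in>T - {r}. e = {u, the (p u)}) \<longleftrightarrow> c e = 1"
      using colour_eq[of v] pq[of v] by (simp add: root) (simp add: T_def)
    then show "(\<lambda>e\<in>E. of_bool (\<exists>v\<in>T - {r}. e = {v, the (p v)})) e = c e"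
      using e PiE_mem[OF c e] by auto
  qed (use c in \<open>auto simp: PiE_def\<close>)
  then have "coloured_tree I (p, T) = s" by (simp add: coloured_tree_def root E sc Let_def)
  then show thesis using that m by blast
qed

section \<open>Naturality: pushing edges and colours forward along a bijection\<close>

lemma inj_on_image_edges:
  assumes "inj_on f V" "\<And>e. e \<in> E \<Longrightarrow> e \<subseteq> V"
  shows "inj_on ((`) f) E"
  using assms by (meson inj_on_image_eq_iff inj_onI)

text \<open>An extensional function is determined by its values at the points \<open>g a\<close>;
  this removes the inverse in \<open>push_map\<close> from the naturality arguments.\<close>

lemma push_map_eqI:
  assumes "inj_on g A" "\<And>a. a \<in> A \<Longrightarrow> c' (g a) = h a (c a)" "c' \<in> extensional (g ` A)"
  shows "push_map g h A c = c'"
proof (rule extensionalityI[of _ "g ` A"])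
  fix b assume "b \<in> g ` A"
  then show "push_map g h A c b = c' b" using assms(1,2) by (auto simp: push_map_def)
qed (use assms(3) in \<open>auto simp: push_map_def\<close>)

text \<open>\<open>f\<close> carries root and parents along, and on both sides the colour of an edge
  is the mark of its child end.\<close>

lemma coloured_tree_transp:
  fixes I :: "'a set"
  assumes f: "bij_betw f I J" and s: "s \<in> struct marked_parent_maps I"
  shows "coloured_tree J (transp marked_parent_maps I f s)
    = transp two_coloured_rooted_trees I f (coloured_tree I s)"
proof -
  obtain p T where sp: "s = (p, T)" and m: "marked_parent_map I p T"
    using s by (auto simp: marked_parent_maps_def)
  have inj: "inj_on f I" and J: "J = f ` I" using f by (auto simp: bij_betw_def)
  define p' where "p' = (\<lambda>w\<in>f ` I. map_option f (p (inv_into I f w)))"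
  interpret M: marked_parent_map I p T by (rule m)
  interpret M': marked_parent_map J p' "f ` T"
    unfolding p'_def J by (rule marked_parent_map_transp[OF m inj])
  have p': "p' (f v) = map_option f (p v)" if "v \<in> I" for v using inj that by (simp add: p'_def)
  have r: "M'.root = f M.root"
    using M'.root_eq[of "f M.root"] M.root p'[of M.root] J by auto
  have edge: "f ` {v, the (p v)} = {f v, the (p' (f v))}" if "v \<in> I" "v \<noteq> M.root" for v
    using M.p_Some[OF that] p'[OF that(1)] by auto
  let ?E = "parent_edges I M.root (the \<circ> p)"
  have "f ` I - {f M.root} = f ` (I - {M.root})" using inj M.root by (auto dest: inj_onD)
  then have E: "parent_edges J M'.root (the \<circ> p') = (`) f ` ?E"
    unfolding r unfolding J parent_edges_def image_image
    by (simp only: image_image comp_apply) (intro image_cong, use edge in auto)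
  have "e \<subseteq> I" if "e \<in> ?E" for e
    using that M.p_Some by (force simp: parent_edges_def)
  then have injE: "inj_on ((`) f) ?E" using inj inj_on_image_edges by blast
  have "push_map ((`) f) (\<lambda>_ x. x) ?E (\<lambda>e\<in>?E. of_bool (\<exists>v\<in>T - {M.root}. e = {v, the (p v)}))
      = (\<lambda>e\<in>(`) f ` ?E. of_bool (\<exists>v\<in>f ` T - {f M.root}. e = {v, the (p' v)}) :: nat)"
  proof (rule push_map_eqI[OF injE])
    fix e assume e: "e \<in> ?E"
    then obtain v where v: "v \<in> I" "v \<noteq> M.root" "e = {v, the (p v)}" by (auto simp: parent_edges_def)
    have "f v \<noteq> f M.root" using v(1,2) M.root(1) inj by (auto dest: inj_onD)
    then have fv: "f v \<in> J" "f v \<noteq> M'.root" using v(1) J r by (blast, simp)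
    have "(\<exists>u\<in>f ` T - {f M.root}. f ` e = {u, the (p' u)}) \<longleftrightarrow> f v \<in> f ` T"
      using M'.colour_eq[OF fv] edge[OF v(1,2)] v(3) by (simp add: r)
    also have "\<dots> \<longleftrightarrow> v \<in> T" using inj_on_image_mem_iff[OF inj v(1) M.T_sub] .
    also have "\<dots> \<longleftrightarrow> (\<exists>u\<in>T - {M.root}. e = {u, the (p u)})" using M.colour_eq[OF v(1,2)] v(3) by simp
    finally show "(\<lambda>e\<in>(`) f ` ?E. of_bool (\<exists>v\<in>f ` T - {f M.root}. e = {v, the (p' v)})) (f ` e)
        = (\<lambda>e\<in>?E. of_bool (\<exists>v\<in>T - {M.root}. e = {v, the (p v)}) :: nat) e"
      using e by simp
  qed simp
  then show ?thesis
    unfolding sp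
    by (simp add: marked_parent_maps_def two_coloured_rooted_trees_def map_rtree_def
        coloured_tree_def Let_def E flip: p'_def) (simp add: r)
qed

lemma marked_parent_maps_iso_coloured_trees:
  "species_isomorphic (marked_parent_maps :: ('a, _) species_data) two_coloured_rooted_trees"
proof (rule species_isomorphicI[OF species_marked_parent_maps])
  fix I :: "'a set" assume I: "finite I"
  show "bij_betw (coloured_tree I) (struct marked_parent_maps I) (struct two_coloured_rooted_trees I)"
    unfolding bij_betw_def
  proof
    show "inj_on (coloured_tree I) (struct marked_parent_maps I)"
      by (rule inj_onI) (auto simp: marked_parent_maps_def dest: coloured_tree_inj)
    have "coloured_tree I s \<in> struct two_coloured_rooted_trees I"
      if "s \<in> struct marked_parent_maps I" for s
      using that marked_parent_map.coloured_tree_in[OF _ I] by (auto simp: marked_parent_maps_def)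
    moreover have "s \<in> coloured_tree I ` struct marked_parent_maps I"
      if s: "s \<in> struct two_coloured_rooted_trees I" for s
    proof -
      obtain p T where "marked_parent_map I p T" "coloured_tree I (p, T) = s"
        by (rule coloured_tree_surj[OF I s])
      then show ?thesis by (force simp: marked_parent_maps_def)
    qed
    ultimately show "coloured_tree I ` struct marked_parent_maps I = struct two_coloured_rooted_trees I"
      by blast
  qed
qed (rule coloured_tree_transp)

section \<open>Decorated hollow hypertrees as marked parent maps\<close>

text \<open>
  Cutting the tree above every marked vertex leaves blocks, each with a marked vertex as root.
  A block together with the parent of its root is an edge of the hypertree, and that parent is
  its petiole.
\<close>

definition block_step :: "'a set \<Rightarrow> ('a \<Rightarrow> 'a option) \<Rightarrow> 'a set \<Rightarrow> 'a rel" where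
  "block_step I p T = {(v, w). v \<in> I - T \<and> p v = Some w}"

text \<open>Steps leave only unmarked vertices, so a path ends at the first marked vertex it meets.
  For marked \<open>t\<close> the block thus collects the vertices whose nearest marked ancestor,
  themselves included, is \<open>t\<close>.\<close>

definition block :: "'a set \<Rightarrow> ('a \<Rightarrow> 'a option) \<Rightarrow> 'a set \<Rightarrow> 'a \<Rightarrow> 'a set" where
  "block I p T t = {v\<in>I. (v, t) \<in> (block_step I p T)\<^sup>*}"

definition block_edge :: "'a set \<Rightarrow> ('a \<Rightarrow> 'a option) \<Rightarrow> 'a set \<Rightarrow> 'a \<Rightarrow> 'a option set" where
  "block_edge I p T t = insert (p t) (Some ` block I p T t)"

definition block_tree :: "'a set \<Rightarrow> ('a \<Rightarrow> 'a option) \<Rightarrow> 'a set \<Rightarrow> 'a \<Rightarrow> 'a option rtree" where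
  "block_tree I p T t = (Some t, parent_edges (Some ` block I p T t) (Some t) (\<lambda>x. p (the x)))"

text \<open>The decoration is a function of the edge alone, so the marked vertex is recovered from
  it by \<open>inv_into\<close>; this is legitimate once \<open>block_edge\<close> is known to be
  injective on \<open>T\<close>.\<close>

definition block_hypertree ::
  "'a set \<Rightarrow> ('a \<Rightarrow> 'a option) \<times> 'a set \<Rightarrow> 'a option set set \<times> ('a option set \<Rightarrow> 'a option rtree)" where
  "block_hypertree I = (\<lambda>(p, T). (block_edge I p T ` T,
     \<lambda>e\<in>block_edge I p T ` T. block_tree I p T (inv_into T (block_edge I p T) e)))"

section \<open>The partition of the vertices into blocks, and the resulting hollow hypertree\<close>

context marked_parent_map
begin

abbreviation "blk \<equiv> block I p T"
abbreviation "edg \<equiv> block_edge I p T"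

lemma block_root: "t \<in> T \<Longrightarrow> t \<in> blk t"
  using T_sub by (auto simp: block_def)

lemma block_parent:
  assumes "v \<in> blk t" "v \<noteq> t"
  obtains w where "p v = Some w" "w \<in> blk t" "v \<notin> T"
proof -
  have "(v, t) \<in> (block_step I p T)\<^sup>*" "v \<in> I" using assms by (auto simp: block_def)
  from this(1) assms(2) obtain w where w: "(v, w) \<in> block_step I p T" "(w, t) \<in> (block_step I p T)\<^sup>*"
    by (metis converse_rtranclE)
  then have "p v = Some w" "w \<in> I" "v \<notin> T" using p_SomeD by (auto simp: block_step_def)
  then show thesis using that w by (auto simp: block_def)
qed

text \<open>No step leaves a marked vertex.\<close>

lemma block_marked: "v \<in> blk t \<Longrightarrow> v \<in> T \<Longrightarrow> v = t"
  by (metis block_parent)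

text \<open>Climbing from \<open>v\<close> lowers the rank and meets a marked vertex at the root at
  the latest.\<close>

lemma block_cover:
  assumes "v \<in> I"
  obtains t where "t \<in> T" "v \<in> blk t"
proof -
  obtain h :: "'a option \<Rightarrow> nat" where h: "\<forall>v\<in>I. h (p v) < h (Some v)" using rank_ex by blast
  have "\<exists>t\<in>T. v \<in> blk t" using assms
  proof (induction "h (Some v)" arbitrary: v rule: less_induct)
    case less
    show ?case
    proof (cases "v \<in> T")
      case False
      then obtain w where w: "p v = Some w" "w \<in> I"
        using less.prems root_in_T p_SomeD by (cases "p v") auto
      then have "h (Some w) < h (Some v)" using h less.prems by metis
      then obtain t where t: "t \<in> T" "w \<in> blk t" using less.hyps w by blast
      have "(v, w) \<in> block_step I p T" using False w less.prems by (auto simp: block_step_def)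
      then have "v \<in> blk t" using t less.prems
        by (auto simp: block_def intro: converse_rtrancl_into_rtrancl)
      then show ?thesis using t by blast
    qed (use block_root in blast)
  qed
  then show thesis using that by blast
qed

text \<open>Steps are single-valued, so of two paths from \<open>v\<close> one continues the other;
  but a path cannot continue beyond a marked vertex.\<close>

lemma block_disjoint:
  assumes "v \<in> blk t" "v \<in> blk t'" "t \<in> T" "t' \<in> T"
  shows "t = t'"
proof -
  have "single_valued (block_step I p T)" by (auto simp: single_valued_def block_step_def)
  then have "(t, t') \<in> (block_step I p T)\<^sup>* \<or> (t', t) \<in> (block_step I p T)\<^sup>*"
    using assms by (intro single_valued_confluent[of _ v]) (auto simp: block_def)
  then have "t \<in> blk t' \<or> t' \<in> blk t" using assms T_sub by (auto simp: block_def)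
  then show ?thesis using block_marked assms by metis
qed

lemma block_rank:
  fixes h :: "'a option \<Rightarrow> nat"
  assumes h: "\<forall>v\<in>I. h (p v) < h (Some v)" and v: "v \<in> blk t"
  shows "h (Some t) \<le> h (Some v)"
proof -
  have "(v, t) \<in> (block_step I p T)\<^sup>*" using v by (simp add: block_def)
  then show ?thesis
  proof (induction rule: converse_rtrancl_induct)
    case (step u w)
    then have "h (Some w) < h (Some u)" using h by (fastforce simp: block_step_def)
    then show ?case using step.IH by simp
  qed simp
qed

text \<open>The rank of a block is least at its marked vertex \<open>t\<close>, and
  \<open>p t\<close> ranks lower still. So the petiole lies outside the block and below all of
  it.\<close>

lemma rank_obtain:
  obtains h :: "'a option \<Rightarrow> nat" where "\<forall>v\<in>I. h (p v) < h (Some v)"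
    "\<And>v t. v \<in> blk t \<Longrightarrow> t \<in> T \<Longrightarrow> h (p t) < h (Some v)"
proof -
  obtain h :: "'a option \<Rightarrow> nat" where h: "\<forall>v\<in>I. h (p v) < h (Some v)" using rank_ex by blast
  have "h (p t) < h (Some v)" if "v \<in> blk t" "t \<in> T" for v t
    using block_rank[OF h that(1)] h that(2) T_sub by (meson le_less_trans not_le subsetD)
  then show thesis using that h by blast
qed

lemma petiole_notin_block: "t \<in> T \<Longrightarrow> p t \<notin> Some ` blk t"
  by (metis imageE less_irrefl rank_obtain)

lemma edge_minus_petiole: "t \<in> T \<Longrightarrow> edg t - {p t} = Some ` blk t"
  using petiole_notin_block by (auto simp: block_edge_def)

text \<open>If different \<open>t\<close> and \<open>s\<close> had the same edge, each would be a
  vertex of the other's edge outside the other's block, hence its petiole: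
  \<open>p s = Some t\<close> and \<open>p t = Some s\<close>, against the rank.\<close>

lemma inj_on_block_edge: "inj_on edg T"
proof (rule inj_onI)
  fix t s assume ts: "t \<in> T" "s \<in> T" "edg t = edg s"
  obtain h :: "'a option \<Rightarrow> nat" where h: "\<forall>v\<in>I. h (p v) < h (Some v)" using rank_ex by blast
  show "t = s"
  proof (rule ccontr)
    assume "t \<noteq> s"
    then have "t \<notin> blk s" "s \<notin> blk t" using block_marked ts by metis+
    moreover have "Some t \<in> edg s" "Some s \<in> edg t"
      using block_root ts by (auto simp: block_edge_def)
    ultimately have "p s = Some t" "p t = Some s" by (auto simp: block_edge_def)
    then show False using h ts T_sub by (metis less_asym' subsetD)
  qed
qed

lemma inv_block_edge: "t \<in> T \<Longrightarrow> inv_into T edg (edg t) = t"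
  using inj_on_block_edge by simp

text \<open>Blocks partition \<open>I\<close>, so each vertex is a non-petiole of exactly one edge.
  The gap occurs only as the parent of the root, which makes the edge of the root the hollow
  one.\<close>

lemma petiole_map_block_edges: "petiole_map I (edg ` T) (\<lambda>e. p (inv_into T edg e))"
  unfolding petiole_map_def
proof (intro conjI ballI)
  fix e assume "e \<in> edg ` T"
  then obtain t where t: "t \<in> T" "e = edg t" by blast
  have pt: "p (inv_into T edg e) = p t" using t inv_block_edge by simp
  have "p t \<in> with_gap I" using p_closed t T_sub by auto
  then show "e \<subseteq> with_gap I" using t by (auto simp: block_edge_def block_def with_gap_def)
  show "p (inv_into T edg e) \<in> e" unfolding pt using t by (auto simp: block_edge_def)
  show "e \<noteq> {p (inv_into T edg e)}"
    unfolding pt using edge_minus_petiole[OF t(1)] block_root[OF t(1)] t(2) by auto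
  show "None \<in> e \<longrightarrow> p (inv_into T edg e) = None" unfolding pt using t by (auto simp: block_edge_def)
next
  fix v assume v: "v \<in> I"
  obtain t where t: "t \<in> T" "v \<in> blk t" using block_cover v by blast
  show "\<exists>!e. e \<in> edg ` T \<and> Some v \<in> e \<and> p (inv_into T edg e) \<noteq> Some v"
  proof (rule ex1I)
    show "edg t \<in> edg ` T \<and> Some v \<in> edg t \<and> p (inv_into T edg (edg t)) \<noteq> Some v"
      using t petiole_notin_block[OF t(1)] inv_block_edge[OF t(1)] by (force simp: block_edge_def)
    fix e assume e: "e \<in> edg ` T \<and> Some v \<in> e \<and> p (inv_into T edg e) \<noteq> Some v"
    then obtain s where s: "s \<in> T" "e = edg s" by blast
    then have "v \<in> blk s" using e inv_block_edge[OF s(1)] by (auto simp: block_edge_def)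
    then show "e = edg t" using block_disjoint s t by blast
  qed
next
  show "\<exists>!e. e \<in> edg ` T \<and> None \<in> e"
  proof (rule ex1I)
    show "edg root \<in> edg ` T \<and> None \<in> edg root"
      using root by (intro conjI imageI) (auto simp: block_edge_def)
    fix e assume "e \<in> edg ` T \<and> None \<in> e"
    then obtain s where s: "s \<in> T" "e = edg s" "p s = None" by (auto simp: block_edge_def)
    then show "e = edg root" using root_eq T_sub by blast
  qed
next
  obtain h :: "'a option \<Rightarrow> nat" where h: "\<And>v t. v \<in> blk t \<Longrightarrow> t \<in> T \<Longrightarrow> h (p t) < h (Some v)"
    by (rule rank_obtain) blast
  have "h (p (inv_into T edg e)) < h x"
    if e: "e \<in> edg ` T" and x: "x \<in> e - {p (inv_into T edg e)}" for e x
  proof -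
    obtain t where t: "t \<in> T" "e = edg t" using e by blast
    then obtain v where "x = Some v" "v \<in> blk t"
      using x edge_minus_petiole[OF t(1)] inv_block_edge[OF t(1)] by auto
    then show ?thesis using h t inv_block_edge by simp
  qed
  then show "\<exists>h::'a option \<Rightarrow> nat. \<forall>e\<in>edg ` T. \<forall>v\<in>e - {p (inv_into T edg e)}.
      h (p (inv_into T edg e)) < h v" by blast
qed

text \<open>Identifies the petiole defined by distance with \<open>p t\<close>, so that the vertex
  set prescribed for the decoration of an edge is the block.\<close>

lemma hollow_hypertree_block_edges:
  assumes "finite I"
  shows "hollow_hypertree I (edg ` T)" and "t \<in> T \<Longrightarrow> petiole (edg ` T) (edg t) = p t"
  using petiole_map_hollow_hypertree[OF assms petiole_map_block_edges] inv_block_edge by auto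

section \<open>Decorations of the blocks, and recovering the marked parent map from them\<close>

lemma parent_map_block:
  assumes "t \<in> T"
  shows "parent_map (Some ` blk t) (Some t) (\<lambda>x. p (the x))"
proof -
  obtain h :: "'a option \<Rightarrow> nat" where h: "\<forall>v\<in>I. h (p v) < h (Some v)" using rank_ex by blast
  have "p (the x) \<in> Some ` blk t" if x: "x \<in> Some ` blk t - {Some t}" for x
  proof -
    obtain v where v: "x = Some v" "v \<in> blk t" "v \<noteq> t" using x by auto
    obtain w where "p v = Some w" "w \<in> blk t" "v \<notin> T" by (rule block_parent[OF v(2,3)])
    then show ?thesis using v by simp
  qed
  moreover have "h (p (the x)) < h x" if "x \<in> Some ` blk t" for x
    using that h by (auto simp: block_def)
  ultimately show ?thesis
    unfolding parent_map_def using block_root[OF assms] by blast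
qed

lemma block_tree_rooted_tree:
  assumes "finite I" "t \<in> T"
  shows "block_tree I p T t \<in> rooted_trees (Some ` blk t)"
proof -
  have "finite (Some ` blk t)" using assms by (simp add: block_def)
  then show ?thesis
    using parent_edges_tree_graph[OF _ parent_map_block[OF assms(2)]] block_root[OF assms(2)]
    by (simp add: rooted_trees_def block_tree_def)
qed

lemma block_hypertree_apply: "t \<in> T \<Longrightarrow> snd (block_hypertree I (p, T)) (edg t) = block_tree I p T t"
  by (simp add: block_hypertree_def inv_block_edge)

lemma block_hypertree_in:
  assumes I: "finite I"
  shows "block_hypertree I (p, T) \<in> struct hollow_hypertrees_PreLie I"
proof -
  have "block_tree I p T t \<in> rooted_trees (edg t - {petiole (edg ` T) (edg t)})" if "t \<in> T" for t
    using block_tree_rooted_tree[OF I that] edge_minus_petiole[OF that]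
      hollow_hypertree_block_edges(2)[OF I that] by simp
  then show ?thesis
    using hollow_hypertree_block_edges(1)[OF I]
    by (auto simp: hollow_hypertrees_PreLie_def decorated_hollow_hypertrees_def PreLie_def
        block_hypertree_def inv_block_edge)
qed

end

text \<open>The roots of the decorations give back \<open>T\<close>, the petioles give
  \<open>p\<close> on \<open>T\<close>, and the edges of the decorations give \<open>p\<close> on
  the unmarked vertices.\<close>

lemma block_hypertree_inj:
  assumes I: "finite I" and m: "marked_parent_map I p T" "marked_parent_map I p' T'"
    and eq: "block_hypertree I (p, T) = block_hypertree I (p', T')"
  shows "p = p' \<and> T = T'"
proof -
  interpret M: marked_parent_map I p T by (rule m)
  interpret M': marked_parent_map I p' T' by (rule m)
  have E: "M.edg ` T = M'.edg ` T'" using arg_cong[OF eq, of fst] by (simp add: block_hypertree_def)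
  have same: "t \<in> T' \<and> M'.edg t = M.edg t \<and> block_tree I p T t = block_tree I p' T' t" if t: "t \<in> T" for t
  proof -
    obtain s where s: "s \<in> T'" "M.edg t = M'.edg s" using E t by blast
    then have "block_tree I p T t = block_tree I p' T' s"
      using M.block_hypertree_apply[OF t] M'.block_hypertree_apply[OF s(1)] eq by simp
    moreover then have "s = t" by (simp add: block_tree_def)
    ultimately show ?thesis using s by simp
  qed
  have "t \<in> T" if t: "t \<in> T'" for t
  proof -
    obtain s where s: "s \<in> T" "M.edg s = M'.edg t" using E t by (metis imageE imageI)
    then have "block_tree I p T s = block_tree I p' T' t"
      using M.block_hypertree_apply[OF s(1)] M'.block_hypertree_apply[OF t] eq by simp
    then have "s = t" by (simp add: block_tree_def)
    then show ?thesis using s by simp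
  qed
  then have T: "T = T'" using same by blast
  have pT: "p t = p' t" if t: "t \<in> T" for t
    using M.hollow_hypertree_block_edges(2)[OF I t] M'.hollow_hypertree_block_edges(2)[OF I, of t]
      same[OF t] E t by simp
  have "p v = p' v" if "v \<in> I" for v
  proof -
    obtain t where t: "t \<in> T" "v \<in> M.blk t" using M.block_cover \<open>v \<in> I\<close> by blast
    show ?thesis
    proof (cases "v = t")
      case True
      then show ?thesis using pT t by simp
    next
      case False
      \<comment> \<open>A block is its edge without the petiole, and edges and petioles already
        agree.\<close>
      have "Some ` M'.blk t = Some ` M.blk t"
        using M.edge_minus_petiole[OF t(1)] M'.edge_minus_petiole[of t] same[OF t(1)] pT[OF t(1)] by simp
      moreover from this have "parent_edges (Some ` M.blk t) (Some t) (\<lambda>x. p (the x))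
          = parent_edges (Some ` M.blk t) (Some t) (\<lambda>x. p' (the x))"
        using same[OF t(1)] by (simp add: block_tree_def)
      ultimately have "p (the (Some v)) = p' (the (Some v))"
        using M.parent_map_block[OF t(1)] M'.parent_map_block[of t] same[OF t(1)] t(2) False
        by (intro parent_map_unique[of "Some ` M.blk t" "Some t" "\<lambda>x. p (the x)" "\<lambda>x. p' (the x)"]) auto
      then show ?thesis by simp
    qed
  qed
  then have "p = p'" using M.p_closed M'.p_closed by (intro PiE_ext) auto
  then show ?thesis using T by simp
qed

lemma parent_edges_cong:
  "(\<And>v. v \<in> V \<Longrightarrow> v \<noteq> r \<Longrightarrow> p v = q v) \<Longrightarrow> parent_edges V r p = parent_edges V r q"
  by (auto simp: parent_edges_def)

text \<open>Each vertex is a non-petiole of exactly one edge \<open>below v\<close>. Following the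
  decorations inside the edges and jumping from their roots to the petioles gives \<open>p\<close>.
  The work lies in a global rank and in seeing that the blocks of \<open>p\<close> are the given
  edges without their petioles.\<close>

lemma block_hypertree_surj:
  assumes I: "finite I" and s: "s \<in> struct hollow_hypertrees_PreLie I"
  obtains p T where "marked_parent_map I p T" "block_hypertree I (p, T) = s"
proof -
  obtain E d where sE: "s = (E, d)" and hh: "hollow_hypertree I E"
    and d: "d \<in> (\<Pi>\<^sub>E e\<in>E. rooted_trees (e - {petiole E e}))"
    using s by (auto simp: hollow_hypertrees_PreLie_def decorated_hollow_hypertrees_def PreLie_def)
  define pt where "pt = petiole E"
  have pm: "petiole_map I E pt" unfolding pt_def by (rule hollow_hypertree_petiole_map[OF hh])
  have e: "\<And>e. e \<in> E \<Longrightarrow> e \<subseteq> with_gap I \<and> pt e \<in> e \<and> e \<noteq> {pt e} \<and> (None \<in> e \<longrightarrow> pt e = None)"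
    and bel: "\<And>v. v \<in> I \<Longrightarrow> \<exists>!e. e \<in> E \<and> Some v \<in> e \<and> pt e \<noteq> Some v"
    and hol: "\<exists>!e. e \<in> E \<and> None \<in> e"
    using pm by (auto simp: petiole_map_def)
  obtain H :: "'a option \<Rightarrow> nat" where H: "\<And>e v. e \<in> E \<Longrightarrow> v \<in> e - {pt e} \<Longrightarrow> H (pt e) < H v"
    using pm[unfolded petiole_map_def, THEN conjunct2, THEN conjunct2, THEN conjunct2] by blast
  define below where "below v = (THE e. e \<in> E \<and> Some v \<in> e \<and> pt e \<noteq> Some v)" for v
  have below: "below v \<in> E" "Some v \<in> below v - {pt (below v)}" if "v \<in> I" for v
    using theI'[OF bel[OF that]] unfolding below_def by auto
  have below_ex: "\<exists>v. x = Some v \<and> v \<in> I \<and> below v = a" if a: "a \<in> E" "x \<in> a - {pt a}" for a x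
  proof -
    obtain v where v: "x = Some v" "v \<in> I" using e[OF a(1)] a by (cases x) (auto simp: with_gap_def)
    moreover have "below v = a"
      unfolding below_def by (rule the1_equality[OF bel[OF v(2)]]) (use a v in auto)
    ultimately show ?thesis by blast
  qed
  have below_set: "a - {pt a} = Some ` {v\<in>I. below v = a}" if "a \<in> E" for a
    using below_ex[OF that] below by auto
  define rt where "rt a = fst (d a)" for a
  have tree: "rt a \<in> a - {pt a} \<and> tree_graph (a - {pt a}) (snd (d a))" if "a \<in> E" for a
    using PiE_mem[OF d that] by (auto simp: rt_def rooted_trees_def pt_def)
  then have "\<exists>q. parent_map (a - {pt a}) (rt a) q \<and> parent_edges (a - {pt a}) (rt a) q = snd (d a)"
    if "a \<in> E" for a
    using that tree_graph_parent_map by metis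
  then obtain q where q: "\<And>a. a \<in> E \<Longrightarrow> parent_map (a - {pt a}) (rt a) (q a)"
    and qE: "\<And>a. a \<in> E \<Longrightarrow> parent_edges (a - {pt a}) (rt a) (q a) = snd (d a)" by metis
  have "\<exists>h::'a option \<Rightarrow> nat. \<forall>v\<in>a - {pt a} - {rt a}. h (q a v) < h v" if "a \<in> E" for a
    using q[OF that] by (simp add: parent_map_def)
  then obtain h :: "'a option set \<Rightarrow> 'a option \<Rightarrow> nat"
    where h: "\<And>a v. a \<in> E \<Longrightarrow> v \<in> a - {pt a} - {rt a} \<Longrightarrow> h a (q a v) < h a v" by metis
  have q_mem: "q a x \<in> a - {pt a}" if "a \<in> E" "x \<in> a - {pt a}" "x \<noteq> rt a" for a x
    using q[OF that(1)] that by (auto simp: parent_map_def)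
  define p where "p = (\<lambda>v\<in>I. if Some v = rt (below v) then pt (below v) else q (below v) (Some v))"
  define T where "T = {v\<in>I. Some v = rt (below v)}"
  have p_T: "p v = pt (below v)" if "v \<in> T" for v using that by (simp add: p_def T_def)
  have p_below: "\<exists>w. p v = Some w \<and> w \<in> I \<and> below w = below v \<and> p v = q (below v) (Some v)
      \<and> Some v \<noteq> rt (below v)"
    if v: "v \<in> I" "v \<notin> T" for v
  proof -
    have pv: "p v = q (below v) (Some v)" "Some v \<noteq> rt (below v)" using v by (auto simp: p_def T_def)
    then have "p v \<in> below v - {pt (below v)}" using q_mem[OF below[OF v(1)]] by simp
    then show ?thesis using below_ex[OF below(1)[OF v(1)]] pv by metis
  qed
  have root_below: "\<exists>t\<in>T. rt a = Some t \<and> below t = a" if a: "a \<in> E" for a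
    using below_ex[OF a] tree[OF a] by (fastforce simp: T_def)
  have T_eq: "v = w" if "v \<in> T" "w \<in> T" "below v = below w" for v w
    using that by (auto simp: T_def) (metis option.inject)
  have rank: "\<exists>k::'a option \<Rightarrow> nat. \<forall>v\<in>I. k (p v) < k (Some v)"
  proof -
    \<comment> \<open>\<open>k\<close> encodes a lexicographic order: first the rank
      \<open>H\<close> of the petiole, then the local rank in the decoration. \<open>K\<close>
      exceeds all local ranks, and \<open>Suc\<close> lifts every vertex above the gap.\<close>
    define K where "K = Suc (Max ((\<lambda>v. h (below v) (Some v)) ` I))"
    define k where "k = case_option 0 (\<lambda>v. Suc (H (pt (below v)) * K + h (below v) (Some v)))"
    have hK: "h (below v) (Some v) < K" if "v \<in> I" for v
      using I that by (simp add: K_def less_Suc_eq_le)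
    have "k (p v) < k (Some v)" if v: "v \<in> I" for v
    proof (cases "v \<in> T")
      case True
      show ?thesis
      proof (cases "p v")
        case (Some w)
        then have pw: "pt (below v) = Some w" using p_T[OF True] by simp
        then have w: "w \<in> I" using e[OF below(1)[OF v]] by (auto simp: with_gap_def)
        \<comment> \<open>The petiole \<open>Some w\<close> of one edge is a non-petiole of its own
          edge \<open>below w\<close>, so the leading term drops.\<close>
        have "H (pt (below w)) < H (pt (below v))" using H[OF below[OF w]] pw by simp
        then have "Suc (H (pt (below w))) * K \<le> H (pt (below v)) * K" by (intro mult_right_mono) auto
        then have "H (pt (below w)) * K + h (below w) (Some w) < H (pt (below v)) * K"
          using hK[OF w] by simp
        then show ?thesis using Some by (simp add: k_def)
      qed (simp add: k_def)
    next
      case False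
      obtain w where w: "p v = Some w" "w \<in> I" "below w = below v" "p v = q (below v) (Some v)"
        "Some v \<noteq> rt (below v)" using p_below[OF v False] by blast
      have "h (below v) (p v) < h (below v) (Some v)" 
        using h[OF below(1)[OF v], of "Some v"] below(2)[OF v] w(4,5) by simp
      then show ?thesis using w by (simp add: k_def)
    qed
    then show ?thesis by blast
  qed
  obtain a0 where a0: "a0 \<in> E" "None \<in> a0" "\<And>a. a \<in> E \<Longrightarrow> None \<in> a \<Longrightarrow> a = a0" using hol by blast
  have None_T: "v \<in> T \<and> below v = a0" if v: "v \<in> I" "p v = None" for v
  proof -
    \<comment> \<open>An unmarked vertex has its parent in \<open>I\<close>, so \<open>v\<close> is
      marked and the gap is the petiole of its edge.\<close>
    have "v \<in> T" using p_below[OF v(1)] v(2) by fastforce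
    then show ?thesis using p_T e[OF below(1)[OF v(1)]] v a0(3)[OF below(1)[OF v(1)]] by metis
  qed
  have m: "marked_parent_map I p T"
  proof
    have "p v \<in> with_gap I" if v: "v \<in> I" for v
    proof (cases "v \<in> T")
      case True
      then show ?thesis using p_T e[OF below(1)[OF v]] by auto
    next
      case False
      then show ?thesis using p_below[OF v] by (auto simp: with_gap_def)
    qed
    then show "p \<in> I \<rightarrow>\<^sub>E with_gap I" by (auto simp: p_def)
    show "T \<subseteq> I" by (auto simp: T_def)
    show "v \<in> T" if "v \<in> I" "p v = None" for v using None_T that by blast
    obtain r where r: "r \<in> T" "below r = a0" using root_below[OF a0(1)] by blast
    have "p r = None" using p_T[OF r(1)] e[OF a0(1)] a0(2) r(2) by simp
    then show "\<exists>!r. r \<in> I \<and> p r = None"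
      using r None_T T_eq by (intro ex1I[of _ r]) (auto simp: T_def)
    show "\<exists>k::'a option \<Rightarrow> nat. \<forall>v\<in>I. k (p v) < k (Some v)" by (rule rank)
  qed
  interpret marked_parent_map I p T by (rule m)
  have below_blk: "below v = below t" if "v \<in> blk t" for v t
  proof -
    have "(v, t) \<in> (block_step I p T)\<^sup>*" using that by (simp add: block_def)
    then show ?thesis
    proof (induction rule: converse_rtrancl_induct)
      case (step u w)
      then show ?case using p_below[of u] by (auto simp: block_step_def)
    qed simp
  qed
  have blk: "blk t = {v\<in>I. below v = below t}" if t: "t \<in> T" for t
  proof (intro set_eqI iffI)
    fix v assume "v \<in> blk t"
    then show "v \<in> {v\<in>I. below v = below t}" using below_blk by (auto simp: block_def)
  next
    \<comment> \<open>No path from \<open>v\<close> to \<open>t\<close> is built: \<open>v\<close>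
      lies in the block of some marked \<open>s\<close>, and \<open>s\<close> belongs to the same
      edge as \<open>t\<close>, where only one vertex is marked.\<close>
    fix v assume v: "v \<in> {v\<in>I. below v = below t}"
    then obtain s where s: "s \<in> T" "v \<in> blk s" using block_cover by blast
    then have "s = t" using below_blk[OF s(2)] v t by (intro T_eq) auto
    then show "v \<in> blk t" using s by simp
  qed
  have blk_below: "Some ` blk t = below t - {pt (below t)}" and edg_below: "edg t = below t"
    if t: "t \<in> T" for t
  proof -
    have b: "below t \<in> E" using below t by (auto simp: T_def)
    then show *: "Some ` blk t = below t - {pt (below t)}" using below_set blk[OF t] by simp
    show "edg t = below t" using e[OF b] p_T[OF t] * by (auto simp: block_edge_def)
  qed
  have edgE: "edg ` T = E"
  proof (intro set_eqI iffI)
    fix a assume "a \<in> edg ` T"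
    then show "a \<in> E" using edg_below below by (auto simp: T_def)
  next
    fix a assume "a \<in> E"
    then show "a \<in> edg ` T" using root_below edg_below by force
  qed
  have "block_tree I p T t = d (below t)" if t: "t \<in> T" for t
  proof -
    have b: "below t \<in> E" "Some t = rt (below t)" using below t by (auto simp: T_def)
    have "parent_edges (below t - {pt (below t)}) (rt (below t)) (\<lambda>x. p (the x))
        = parent_edges (below t - {pt (below t)}) (rt (below t)) (q (below t))"
    proof (rule parent_edges_cong)
      fix x assume x: "x \<in> below t - {pt (below t)}" "x \<noteq> rt (below t)"
      obtain v where v: "x = Some v" "v \<in> I" "below v = below t" using below_ex[OF b(1) x(1)] by blast
      then show "p (the x) = q (below t) x" using x(2) by (simp add: p_def)
    qed
    then show ?thesis
      using qE[OF b(1)] b(2) by (simp add: block_tree_def blk_below[OF t]) (simp add: rt_def)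
  qed
  then have "block_tree I p T (inv_into T edg a) = d a" if "a \<in> E" for a
    using that inv_block_edge edg_below edgE by (metis imageE)
  then have "(\<lambda>a\<in>E. block_tree I p T (inv_into T edg a)) = d"
    using d by (intro extensionalityI[of _ E]) (auto simp: PiE_def)
  then have "block_hypertree I (p, T) = s" by (simp add: block_hypertree_def edgE sE)
  then show thesis using that m by blast
qed

text \<open>\<open>f\<close> sends steps to steps, hence blocks to blocks; edges and decorations are
  built from blocks and \<open>p\<close> alone.\<close>

lemma block_hypertree_transp:
  fixes I :: "'a set"
  assumes f: "bij_betw f I J" and s: "s \<in> struct marked_parent_maps I"
  shows "block_hypertree J (transp marked_parent_maps I f s)
    = transp hollow_hypertrees_PreLie I f (block_hypertree I s)"
proof -
  obtain p T where sp: "s = (p, T)" and m: "marked_parent_map I p T"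
    using s by (auto simp: marked_parent_maps_def)
  have inj: "inj_on f I" and J: "J = f ` I" using f by (auto simp: bij_betw_def)
  define p' where "p' = (\<lambda>w\<in>f ` I. map_option f (p (inv_into I f w)))"
  interpret M: marked_parent_map I p T by (rule m)
  interpret M': marked_parent_map J p' "f ` T"
    unfolding p'_def J by (rule marked_parent_map_transp[OF m inj])
  have p': "p' (f v) = map_option f (p v)" if "v \<in> I" for v using inj that by (simp add: p'_def)
  have sub: "f v \<in> M'.blk (f t)" if "v \<in> M.blk t" for v t
  proof -
    have "(v, t) \<in> (block_step I p T)\<^sup>*" "v \<in> I" using that by (auto simp: block_def)
    from this(1) have "(f v, f t) \<in> (block_step J p' (f ` T))\<^sup>*"
    proof (induction rule: converse_rtrancl_induct)
      case (step u w)
      then have u: "u \<in> I" "u \<notin> T" "p u = Some w" by (auto simp: block_step_def)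
      then have "f u \<notin> f ` T" using inj M.T_sub by (simp add: inj_on_image_mem_iff)
      then have "(f u, f w) \<in> block_step J p' (f ` T)" using u p'[of u] J by (auto simp: block_step_def)
      then show ?case using step.IH by (rule converse_rtrancl_into_rtrancl)
    qed simp
    then show ?thesis using \<open>v \<in> I\<close> J by (simp add: block_def)
  qed
  have blk: "M'.blk (f t) = f ` M.blk t" if t: "t \<in> T" for t
  proof (intro set_eqI iffI)
    \<comment> \<open>No path is pulled back: the preimage \<open>v\<close> lies in some block of
      \<open>u\<close>, so \<open>w\<close> lies in the block of \<open>f u\<close>, and
      disjointness gives \<open>f u = f t\<close>.\<close>
    fix w assume w: "w \<in> M'.blk (f t)"
    then obtain v where v: "w = f v" "v \<in> I" using J by (auto simp: block_def)
    obtain u where u: "u \<in> T" "v \<in> M.blk u" using M.block_cover v by blast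
    have "f u = f t" using M'.block_disjoint[of w "f u" "f t"] sub[OF u(2)] w v u t by auto
    then have "u = t" using inj u t M.T_sub by (meson inj_onD subsetD)
    then show "w \<in> f ` M.blk t" using u v by blast
  qed (use sub in auto)
  have edg: "M'.edg (f t) = map_option f ` M.edg t" if t: "t \<in> T" for t
    using blk[OF t] p'[of t] t M.T_sub by (auto simp: block_edge_def image_image)
  have tree: "block_tree J p' (f ` T) (f t) = map_rtree (map_option f) (block_tree I p T t)"
    if t: "t \<in> T" for t
  proof -
    have bI: "M.blk t \<subseteq> I" by (auto simp: block_def)
    then have eq: "f ` M.blk t - {f t} = f ` (M.blk t - {t})"
      using t M.T_sub inj_on_image_set_diff[OF inj, of "M.blk t" "{t}"] by auto
    have Some_diff: "Some ` A - {Some a} = Some ` (A - {a})" for A :: "'a set" and a by auto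
    have "Some ` M'.blk (f t) - {Some (f t)} = Some ` f ` (M.blk t - {t})"
      by (simp only: Some_diff blk[OF t] eq)
    also have "\<dots> = map_option f ` (Some ` M.blk t - {Some t})"
      by (simp add: Some_diff image_image)
    finally have "Some ` M'.blk (f t) - {Some (f t)} = map_option f ` (Some ` M.blk t - {Some t})" .
    moreover have "{map_option f x, p' (the (map_option f x))} = map_option f ` {x, p (the x)}"
      if "x \<in> Some ` M.blk t - {Some t}" for x
      using that bI p' by auto
    ultimately have "parent_edges (Some ` M'.blk (f t)) (Some (f t)) (\<lambda>x. p' (the x))
        = (`) (map_option f) ` parent_edges (Some ` M.blk t) (Some t) (\<lambda>x. p (the x))"
      unfolding parent_edges_def by (simp only: image_image) (intro image_cong, auto)
    then show ?thesis by (simp add: block_tree_def map_rtree_def)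
  qed
  have "inj_on (map_option f) (with_gap I)"
    using inj by (auto simp: inj_on_def with_gap_def)
  moreover have "e \<subseteq> with_gap I" if "e \<in> M.edg ` T" for e
    using that M.petiole_map_block_edges[unfolded petiole_map_def, THEN conjunct1] by blast
  ultimately have injE: "inj_on ((`) (map_option f)) (M.edg ` T)"
    by (rule inj_on_image_edges)
  have E: "M'.edg ` f ` T = (`) (map_option f) ` M.edg ` T"
    unfolding image_image using edg by (intro image_cong) auto
  \<comment> \<open>The transport of \<open>PreLie\<close> ignores the underlying set, so the
    petioles drop out of the equation.\<close>
  have "push_map ((`) (map_option f)) (\<lambda>e. map_rtree (map_option f)) (M.edg ` T)
      (\<lambda>e\<in>M.edg ` T. block_tree I p T (inv_into T M.edg e))
    = (\<lambda>e\<in>M'.edg ` f ` T. block_tree J p' (f ` T) (inv_into (f ` T) M'.edg e))"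
  proof (rule push_map_eqI[OF injE])
    fix e assume "e \<in> M.edg ` T"
    then obtain t where t: "t \<in> T" "e = M.edg t" by blast
    have "map_option f ` e = M'.edg (f t)" using edg t by simp
    then show "(\<lambda>e\<in>M'.edg ` f ` T. block_tree J p' (f ` T) (inv_into (f ` T) M'.edg e)) (map_option f ` e)
        = map_rtree (map_option f) ((\<lambda>e\<in>M.edg ` T. block_tree I p T (inv_into T M.edg e)) e)"
      using t M.inv_block_edge[OF t(1)] M'.inv_block_edge[of "f t"] tree[OF t(1)] by simp
  qed (simp add: E)
  then show ?thesis
    unfolding sp
    by (simp add: marked_parent_maps_def hollow_hypertrees_PreLie_def decorated_hollow_hypertrees_def
        PreLie_def block_hypertree_def E flip: p'_def)
qed

lemma marked_parent_maps_iso_hollow_hypertrees: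
  "species_isomorphic (marked_parent_maps :: ('a, _) species_data) hollow_hypertrees_PreLie"
proof (rule species_isomorphicI[OF species_marked_parent_maps])
  fix I :: "'a set" assume I: "finite I"
  show "bij_betw (block_hypertree I) (struct marked_parent_maps I) (struct hollow_hypertrees_PreLie I)"
    unfolding bij_betw_def
  proof
    show "inj_on (block_hypertree I) (struct marked_parent_maps I)"
      by (rule inj_onI) (auto simp: marked_parent_maps_def dest: block_hypertree_inj[OF I])
    have "block_hypertree I s \<in> struct hollow_hypertrees_PreLie I"
      if "s \<in> struct marked_parent_maps I" for s
      using that marked_parent_map.block_hypertree_in[OF _ I] by (auto simp: marked_parent_maps_def)
    moreover have "s \<in> block_hypertree I ` struct marked_parent_maps I"
      if s: "s \<in> struct hollow_hypertrees_PreLie I" for s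
    proof -
      obtain p T where "marked_parent_map I p T" "block_hypertree I (p, T) = s"
        by (rule block_hypertree_surj[OF I s])
      then show ?thesis by (force simp: marked_parent_maps_def)
    qed
    ultimately show "block_hypertree I ` struct marked_parent_maps I = struct hollow_hypertrees_PreLie I"
      by blast
  qed
qed (rule block_hypertree_transp)

theorem proposition3p3:
  shows "species_isomorphic
    (hollow_hypertrees_PreLie ::
       ('a, 'a option set set \<times> ('a option set \<Rightarrow> 'a option rtree)) species_data)
    (two_coloured_rooted_trees :: ('a, 'a coloured_rtree) species_data)"
  by (rule species_isomorphic_trans[OF
        species_isomorphic_sym[OF marked_parent_maps_iso_hollow_hypertrees]
        marked_parent_maps_iso_coloured_trees])

end
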